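(* Let $(X,d)$ be a compact metric space and let $f:X\to X$ be a positively expansive continuous map with the specification property. Then $$h_{top}(f)=\mathcal{E}(f_{\mathcal{M}},\mathcal{M}_f^{per}(X)).$$
   Context: $h_{top}(f)$ is topological entropy; $d_n(x,y)=\max_{0\le i\le n-1} d(f^ix,f^iy)$. $\mathcal M(X)$ is the set of Borel probability measures on $X$, $f_{\mathcal M}\mu=\mu\circ f^{-1}$. $\mathcal M_f^{per}(X)$ is the set of ergodic $f$-invariant probability measures supported on the orbit of a periodic point. $W_1^n(\mu,\nu)=\inf_{\pi}\int d_n\,d\pi$, infimum over Borel probability measures $\pi$ on $X\times X$ with marginals $\mu,\nu$. For nonempty $\mathcal Z\subset\mathcal M(X)$, $N_{\mathcal M}(\mathcal Z,n,\varepsilon)$ is the smallest cardinality of $E\subset\mathcal M(X)$ with every $\mu\in\mathcal Z$ within $W_1^n$-distance $\le\varepsilon$ of some element of $E$, and $\mathcal E(f_{\mathcal M},\mathcal Z)=\lim_{\varepsilon\to0}\limsup_{n\to\infty}\frac{\log\log N_{\mathcal M}(\mathcal Z,n,\varepsilon)}{n}$ (convention $\log0=0$). $f$ is positively expansive if there is $\rho>0$ such that for distinct $x,y$ there is $n\ge0$ with $d(f^nx,f^ny)>\rho$. $f$ has the specification property if for every $\varepsilon>0$ there is $n_0\in\mathbb N$ such that for any $x_1,\dots,x_k\in X$ and nonnegative integers $n_1,\dots,n_k$, $s_1,\dots,s_k$ with $s_i\ge n_0$, writing $m_j=\sum_{i=1}^j(n_i+s_i)$, $m_0=0$, there is $p\in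 X$ with $d(f^{m_{j-1}+i}p,f^ix_j)<\varepsilon$ for $0\le i<n_j$, $1\le j\le k$. *)

theory Defs
  imports "HOL-Probability.Probability"
begin

definition dn :: "('a::metric_space \<Rightarrow> 'a) \<Rightarrow> nat \<Rightarrow> 'a \<Rightarrow> 'a \<Rightarrow> real" where
  "dn f n x y = Max (insert 0 ((\<lambda>i. dist ((f ^^ i) x) ((f ^^ i) y)) ` {..<n}))"

definition separated :: "('a::metric_space \<Rightarrow> 'a) \<Rightarrow> nat \<Rightarrow> real \<Rightarrow> 'a set \<Rightarrow> bool" where
  "separated f n \<epsilon> E \<longleftrightarrow> (\<forall>x\<in>E. \<forall>y\<in>E. x \<noteq> y \<longrightarrow> dn f n x y > \<epsilon>)"

definition sep_num :: "('a::metric_space \<Rightarrow> 'a) \<Rightarrow> nat \<Rightarrow> real \<Rightarrow> nat" where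
  "sep_num f n \<epsilon> = Sup {card E | E. finite E \<and> separated f n \<epsilon> E}"

definition htop :: "('a::metric_space \<Rightarrow> 'a) \<Rightarrow> ereal" where
  "htop f = Lim (at_right 0)
     (\<lambda>\<epsilon>::real. limsup (\<lambda>n. ereal (ln (real (sep_num f n \<epsilon>)) / real n)))"

definition prob_measures :: "'a::topological_space measure set" where
  "prob_measures = {\<mu>. prob_space \<mu> \<and> sets \<mu> = sets borel}"

definition push :: "('a::topological_space \<Rightarrow> 'a) \<Rightarrow> 'a measure \<Rightarrow> 'a measure" where
  "push f \<mu> = distr \<mu> borel f"

definition invariant_measure :: "('a::topological_space \<Rightarrow> 'a) \<Rightarrow> 'a measure \<Rightarrow> bool" where
  "invariant_measure f \<mu> \<longleftrightarrow> \<mu> \<in> prob_measures \<and> push f \<mu> = \<mu>"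

definition ergodic_measure :: "('a::topological_space \<Rightarrow> 'a) \<Rightarrow> 'a measure \<Rightarrow> bool" where
  "ergodic_measure f \<mu> \<longleftrightarrow> invariant_measure f \<mu> \<and>
     (\<forall>A\<in>sets borel. f -` A = A \<longrightarrow> measure \<mu> A = 0 \<or> measure \<mu> A = 1)"

definition periodic_measures :: "('a::topological_space \<Rightarrow> 'a) \<Rightarrow> 'a measure set" where
  "periodic_measures f = {\<mu>. ergodic_measure f \<mu> \<and>
     (\<exists>p k. k > 0 \<and> (f ^^ k) p = p \<and> measure \<mu> (range (\<lambda>i. (f ^^ i) p)) = 1)}"

definition couplings :: "'a::metric_space measure \<Rightarrow> 'a measure \<Rightarrow> ('a \<times> 'a) measure set" where
  "couplings \<mu> \<nu> = {\<pi>. prob_space \<pi> \<and> sets \<pi> = sets (borel :: ('a \<times> 'a) measure) \<and>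
      distr \<pi> borel fst = \<mu> \<and> distr \<pi> borel snd = \<nu>}"

definition W1n :: "('a::metric_space \<Rightarrow> 'a) \<Rightarrow> nat \<Rightarrow> 'a measure \<Rightarrow> 'a measure \<Rightarrow> real" where
  "W1n f n \<mu> \<nu> = Inf ((\<lambda>\<pi>. integral\<^sup>L \<pi> (\<lambda>(x, y). dn f n x y)) ` couplings \<mu> \<nu>)"

definition cover_num :: "('a::metric_space \<Rightarrow> 'a) \<Rightarrow> 'a measure set \<Rightarrow> nat \<Rightarrow> real \<Rightarrow> nat" where
  "cover_num f Z n \<epsilon> = Inf {card E | E. finite E \<and> E \<subseteq> prob_measures \<and>
      (\<forall>\<mu>\<in>Z. \<exists>\<nu>\<in>E. W1n f n \<mu> \<nu> \<le> \<epsilon>)}"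

text \<open>E(f_M, Z) = lim_{eps->0} limsup_n (log log N_M(Z,n,eps))/n, with log 0 = 0
  (which is Isabelle's convention ln 0 = 0).\<close>
definition meas_entropy_dim :: "('a::metric_space \<Rightarrow> 'a) \<Rightarrow> 'a measure set \<Rightarrow> ereal" where
  "meas_entropy_dim f Z = Lim (at_right 0)
     (\<lambda>\<epsilon>::real. limsup (\<lambda>n. ereal (ln (ln (real (cover_num f Z n \<epsilon>))) / real n)))"

definition pos_expansive :: "('a::metric_space \<Rightarrow> 'a) \<Rightarrow> bool" where
  "pos_expansive f \<longleftrightarrow> (\<exists>\<rho>>0. \<forall>x y. x \<noteq> y \<longrightarrow> (\<exists>n. dist ((f ^^ n) x) ((f ^^ n) y) > \<rho>))"

definition has_specification :: "('a::metric_space \<Rightarrow> 'a) \<Rightarrow> bool" where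
  "has_specification f \<longleftrightarrow> (\<forall>\<epsilon>>0. \<exists>n0::nat. \<forall>(k::nat) (x::nat \<Rightarrow> 'a) (nn::nat \<Rightarrow> nat) (s::nat \<Rightarrow> nat).
      (\<forall>i\<in>{1..k}. s i \<ge> n0) \<longrightarrow>
      (\<exists>p. \<forall>j\<in>{1..k}. \<forall>i<nn j.
         dist ((f ^^ ((\<Sum>l=1..j-1. nn l + s l) + i)) p) ((f ^^ i) (x j)) < \<epsilon>))"

end

theory Submission
  imports Defs "HOL-Real_Asymp.Real_Asymp"
begin

text \<open>
  Upper bound: a periodic measure has finite support, so up to a small \<open>W\<^sub>1\<close>-error it is a rounded
  probability vector on a maximal separated set with \<open>S\<close> points, and there are only
  \<open>exp (S \<cdot> O(log S))\<close> of these.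

  Lower bound: the specification property provides no periodic points by itself. With expansivity, however, an
  orbit shadowing a finite past can be made to land exactly on any prescribed point after a fixed gap.
  Choosing past and future so that the number of ways to cross the gap is minimal makes one crossing
  usable for all nearby pasts and futures; iterating the resulting inverse branch yields periodic
  points shadowing arbitrary orbit segments. Given \<open>S\<close> separated orbit segments of length \<open>n\<close>, every
  word of \<open>L \<approx> S\<^bsup>1 - 3\<beta>\<^esup>\<close> of them thus defines a periodic measure. If two such measures are close,
  then for some offset almost all windows of one orbit are near points of the other orbit, which has
  only about \<open>n L\<close> points; counting the words of this kind shows that a \<open>W\<^sub>1\<close>-ball contains at most a
  fraction \<open>exp (- L)\<close> of the \<open>S\<^bsup>L\<^esup>\<close> words.
\<close>

subsection \<open>Bowen metrics and separated sets\<close>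

lemma dn_0: "dn f 0 x y = 0"
  by (simp add: dn_def)

lemma dn_Suc: "dn f (Suc n) x y = max (dn f n x y) (dist ((f ^^ n) x) ((f ^^ n) y))"
proof -
  have "dn f (Suc n) x y = Max (insert (dist ((f ^^ n) x) ((f ^^ n) y))
      (insert 0 ((\<lambda>i. dist ((f ^^ i) x) ((f ^^ i) y)) ` {..<n})))"
    by (simp add: dn_def lessThan_Suc insert_commute)
  also have "\<dots> = max (dist ((f ^^ n) x) ((f ^^ n) y)) (dn f n x y)"
    unfolding dn_def by (rule Max_insert) auto
  finally show ?thesis by (simp add: max.commute)
qed

lemma dn_nonneg: "0 \<le> dn f n x y"
  by (simp add: dn_def)

lemma dn_le_iff: "0 \<le> c \<Longrightarrow> dn f n x y \<le> c \<longleftrightarrow> (\<forall>i<n. dist ((f ^^ i) x) ((f ^^ i) y) \<le> c)"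
  by (auto simp: dn_def)

lemma dn_gt_iff: "0 \<le> c \<Longrightarrow> c < dn f n x y \<longleftrightarrow> (\<exists>i<n. c < dist ((f ^^ i) x) ((f ^^ i) y))"
  using dn_le_iff[of c f n x y] by (meson not_le)

lemma dist_funpow_le_dn: "i < n \<Longrightarrow> dist ((f ^^ i) x) ((f ^^ i) y) \<le> dn f n x y"
  using dn_le_iff[of "dn f n x y" f n x y] dn_nonneg[of f n x y] by blast

lemma dn_self [simp]: "dn f n x x = 0"
  by (intro antisym dn_nonneg) (simp add: dn_le_iff)

lemma dn_commute: "dn f n x y = dn f n y x"
  by (simp add: dn_def dist_commute)

lemma dn_triangle: "dn f n x z \<le> dn f n x y + dn f n y z"
proof (subst dn_le_iff, goal_cases)
  case 2
  show ?case
  proof (intro allI impI)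
    fix i assume "i < n"
    from dist_funpow_le_dn[OF this, of f x y] dist_funpow_le_dn[OF this, of f y z]
    show "dist ((f ^^ i) x) ((f ^^ i) z) \<le> dn f n x y + dn f n y z"
      using dist_triangle[of "(f ^^ i) x" "(f ^^ i) z" "(f ^^ i) y"] by linarith
  qed
qed (simp add: dn_nonneg)

locale compact_system =
  fixes f :: "'a::metric_space \<Rightarrow> 'a"
  assumes compact_space: "compact (UNIV :: 'a set)"
    and cont: "continuous_on UNIV f"
begin

lemma continuous_funpow: "continuous_on UNIV (f ^^ i)"
proof (induction i)
  case (Suc i)
  then show ?case
    using continuous_on_compose[OF Suc continuous_on_subset[OF cont subset_UNIV]] by simp
qed (simp add: id_def)

lemma tendsto_funpow: "X \<longlonglongrightarrow> x \<Longrightarrow> (\<lambda>k. (f ^^ i) (X k)) \<longlonglongrightarrow> (f ^^ i) x"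
  using continuous_on_tendsto_compose[OF continuous_funpow] by auto

lemma convergent_subsequence:
  fixes X :: "nat \<Rightarrow> 'a"
  obtains r x where "strict_mono (r :: nat \<Rightarrow> nat)" "(\<lambda>k. X (r k)) \<longlonglongrightarrow> x"
  using compact_space unfolding compact_def o_def by (metis UNIV_I)

lemma diameter_bound: obtains D :: real where "D > 0" "\<And>x y :: 'a. dist x y \<le> D"
proof -
  obtain e where e: "\<And>y z :: 'a. dist y z \<le> e"
    using compact_imp_bounded[OF compact_space] bounded_two_points by (metis UNIV_I)
  show ?thesis
    by (rule that[of "max e 1"]) (use e in \<open>auto intro: max.coboundedI1\<close>)
qed

lemma continuous_dn: "continuous_on UNIV (\<lambda>z. dn f n (fst z) (snd z))"
proof (induction n)
  case (Suc n)
  have "continuous_on UNIV (\<lambda>z. (f ^^ n) (fst z :: 'a))" "continuous_on UNIV (\<lambda>z. (f ^^ n) (snd z :: 'a))"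
    by (intro continuous_on_compose2[OF continuous_funpow]; auto intro!: continuous_intros)+
  then show ?case
    unfolding dn_Suc by (intro continuous_intros Suc)
qed (simp add: dn_0)

text \<open>Uniform continuity of the Bowen metric on the compact square, compared at the diagonal
  point \<open>(x, x)\<close>, where it vanishes.\<close>

lemma dn_uniform:
  assumes "e > 0"
  obtains d where "d > 0" "\<And>x y. dist x y < d \<Longrightarrow> dn f n x y < e"
proof -
  have "uniformly_continuous_on UNIV (\<lambda>z. dn f n (fst z) (snd z))"
    using compact_uniformly_continuous[OF continuous_dn]
      compact_Times[OF compact_space compact_space] by simp
  then obtain d where d: "d > 0" "\<And>z w. dist z w < d \<Longrightarrow>
      dist (dn f n (fst z) (snd z)) (dn f n (fst w) (snd w)) < e"
    using assms unfolding uniformly_continuous_on_def by (metis UNIV_I)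
  show ?thesis
  proof (rule that[OF d(1)])
    fix x y :: 'a assume "dist x y < d"
    then show "dn f n x y < e"
      using d(2)[of "(x,y)" "(x,x)"] by (simp add: dist_Pair_Pair dist_commute dist_real_def)
  qed
qed

text \<open>Finitely many balls of radius \<open>d\<close> cover the space, and two points of one
  ball are less than \<open>e\<close> apart in \<open>dn f n\<close>; so the choice of a ball is
  injective on every separated set.\<close>

lemma separated_bounded:
  assumes "e > 0"
  obtains K where "\<And>E. separated f n e E \<Longrightarrow> finite E \<and> card E \<le> K"
proof -
  obtain d where d: "d > 0" "\<And>x y. dist x y < d \<Longrightarrow> dn f n x y < e / 2"
    using dn_uniform[of "e / 2" n] assms by auto
  have "(UNIV :: 'a set) \<subseteq> (\<Union>c\<in>UNIV. ball c d)"
    using d(1) by auto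
  then obtain C where C: "finite C" "(UNIV :: 'a set) \<subseteq> (\<Union>c\<in>C. ball c d)"
    using compactE_image[OF compact_space, of UNIV "\<lambda>c. ball c d"] by auto
  then obtain c where c: "\<And>x. c x \<in> C" "\<And>x :: 'a. dist (c x) x < d"
    by (simp add: subset_eq) metis
  show ?thesis
  proof (rule that[of "card C"])
    fix E assume E: "separated f n e E"
    have "inj_on c E"
    proof (rule inj_onI, rule ccontr)
      fix x y assume "x \<in> E" "y \<in> E" "c x = c y" "x \<noteq> y"
      then have "e < dn f n x y" using E by (auto simp: separated_def)
      moreover have "dn f n x y \<le> dn f n (c x) x + dn f n (c x) y"
        using dn_triangle[of f n x y "c x"] by (simp add: dn_commute)
      ultimately show False
        using d(2)[OF c(2), of x] d(2)[OF c(2), of y] \<open>c x = c y\<close> by simp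
    qed
    then show "finite E \<and> card E \<le> card C"
      using C(1) c(1) by (meson card_inj_on_le finite_imageD finite_subset image_subsetI)
  qed
qed

end

subsection \<open>Periodic points from specification and expansivity\<close>

locale specified_system = compact_system +
  fixes \<rho> :: real
  assumes rho_pos: "\<rho> > 0"
    and expansive: "x \<noteq> y \<Longrightarrow> \<exists>n. dist ((f ^^ n) x) ((f ^^ n) y) > \<rho>"
    and spec_prop: "has_specification f"
begin

section \<open>Expansivity and shadowing with fixed gaps\<close>

lemma expansive_eq: "(\<And>n. dist ((f ^^ n) x) ((f ^^ n) y) \<le> \<rho>) \<Longrightarrow> x = y"
  using expansive[of x y] by (meson not_le)

text \<open>By compactness, counterexamples for every \<open>l\<close> would converge to two
  distinct points whose orbits never part by more than \<rho>.\<close>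

lemma uniform_expansive:
  assumes "d > 0"
  obtains l where "\<And>x y. (\<And>i. i < l \<Longrightarrow> dist ((f ^^ i) x) ((f ^^ i) y) \<le> \<rho>) \<Longrightarrow> dist x y < d"
proof (rule ccontr)
  assume "\<not> thesis"
  then have "\<forall>l. \<exists>x y. (\<forall>i<l. dist ((f ^^ i) x) ((f ^^ i) y) \<le> \<rho>) \<and> d \<le> dist x y"
    by (meson not_le that)
  then obtain X Y where XY: "\<And>l i. i < l \<Longrightarrow> dist ((f ^^ i) (X l)) ((f ^^ i) (Y l)) \<le> \<rho>"
      "\<And>l. d \<le> dist (X l) (Y l)" by metis
  obtain r x where r: "strict_mono (r :: nat \<Rightarrow> nat)" "(\<lambda>k. X (r k)) \<longlonglongrightarrow> x"
    by (rule convergent_subsequence)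
  obtain q y where q: "strict_mono (q :: nat \<Rightarrow> nat)" "(\<lambda>k. Y (r (q k))) \<longlonglongrightarrow> y"
    using convergent_subsequence[of "\<lambda>k. Y (r k)"] by metis
  have x: "(\<lambda>k. X (r (q k))) \<longlonglongrightarrow> x"
    using LIMSEQ_subseq_LIMSEQ[OF r(2) q(1)] by (simp add: o_def)
  have ge: "k \<le> r (q k)" for k
    using seq_suble[OF q(1), of k] seq_suble[OF r(1), of "q k"] by simp
  have "x = y"
  proof (rule expansive_eq)
    fix n
    show "dist ((f ^^ n) x) ((f ^^ n) y) \<le> \<rho>"
    proof (rule LIMSEQ_le_const2[OF tendsto_dist[OF tendsto_funpow[OF x] tendsto_funpow[OF q(2)]]])
      show "\<exists>N. \<forall>k\<ge>N. dist ((f ^^ n) (X (r (q k)))) ((f ^^ n) (Y (r (q k)))) \<le> \<rho>"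
        by (intro exI[of _ "Suc n"] allI impI XY(1)) (use ge in \<open>meson Suc_le_lessD le_trans\<close>)
    qed
  qed
  moreover have "d \<le> dist x y"
    using LIMSEQ_le_const[OF tendsto_dist[OF x q(2)]] XY(2) by blast
  ultimately show False using assms by simp
qed

text \<open>Specification for three segments with every gap equal to the threshold \<open>N\<close>,
  which makes the starting times explicit.\<close>

lemma three_block_shadowing:
  assumes "e > 0"
  obtains N where "\<And>a b c n1 n2 n3. \<exists>p. (\<forall>i<n1. dist ((f ^^ i) p) ((f ^^ i) a) < e) \<and>
     (\<forall>i<n2. dist ((f ^^ (n1 + N + i)) p) ((f ^^ i) b) < e) \<and>
     (\<forall>i<n3. dist ((f ^^ (n1 + N + (n2 + N) + i)) p) ((f ^^ i) c) < e)"
proof -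
  obtain N where N: "\<And>(k::nat) x (nn::nat \<Rightarrow> nat) s. (\<forall>i\<in>{1..k}. s i \<ge> N) \<Longrightarrow>
      (\<exists>p. \<forall>j\<in>{1..k}. \<forall>i<nn j.
         dist ((f ^^ ((\<Sum>l=1..j-1. nn l + s l) + i)) p) ((f ^^ i) (x j)) < e)"
    using spec_prop assms(1) unfolding has_specification_def by metis
  show ?thesis
  proof (rule that[of N])
    fix a b c :: 'a and n1 n2 n3 :: nat
    define nn where "nn j = (if j = 1 then n1 else if j = 2 then n2 else n3)" for j :: nat
    define x where "x j = (if j = 1 then a else if j = 2 then b else c)" for j :: nat
    have "\<exists>p. \<forall>j\<in>{1..3}. \<forall>i<nn j.
         dist ((f ^^ ((\<Sum>l=1..j-1. nn l + N) + i)) p) ((f ^^ i) (x j)) < e"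
      by (rule N) simp
    then obtain p where p: "\<And>j i. j \<in> {1..3} \<Longrightarrow> i < nn j \<Longrightarrow>
         dist ((f ^^ ((\<Sum>l=1..j-1. nn l + N) + i)) p) ((f ^^ i) (x j)) < e"
      by blast
    have "{Suc 0..2} = {1, 2}" by auto
    then show "\<exists>p. (\<forall>i<n1. dist ((f ^^ i) p) ((f ^^ i) a) < e) \<and>
     (\<forall>i<n2. dist ((f ^^ (n1 + N + i)) p) ((f ^^ i) b) < e) \<and>
     (\<forall>i<n3. dist ((f ^^ (n1 + N + (n2 + N) + i)) p) ((f ^^ i) c) < e)"
      using p[of 1] p[of 2] p[of 3]
      by (intro exI[of _ p]) (simp add: nn_def x_def add.assoc)
  qed
qed

lemma word_shadowing:
  assumes "e > 0"
  obtains N where "\<And>x L n. \<exists>p. \<forall>j<L. \<forall>i<n. dist ((f ^^ (j * (n + N) + i)) p) ((f ^^ i) (x j)) < e"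
proof -
  obtain N where N: "\<And>(k::nat) x (nn::nat \<Rightarrow> nat) s. (\<forall>i\<in>{1..k}. s i \<ge> N) \<Longrightarrow>
      (\<exists>p. \<forall>j\<in>{1..k}. \<forall>i<nn j.
         dist ((f ^^ ((\<Sum>l=1..j-1. nn l + s l) + i)) p) ((f ^^ i) (x j)) < e)"
    using spec_prop assms(1) unfolding has_specification_def by metis
  show ?thesis
  proof (rule that[of N])
    fix x :: "nat \<Rightarrow> 'a" and n L :: nat
    \<comment> \<open>Specification numbers blocks from 1, a word numbers its letters from
      0.\<close>
    have "\<exists>p. \<forall>j\<in>{1..L}. \<forall>i<n.
         dist ((f ^^ ((\<Sum>l=1..j-1. n + N) + i)) p) ((f ^^ i) (x (j - 1))) < e"
      by (rule N) simp
    then obtain p where p: "\<And>j i. j \<in> {1..L} \<Longrightarrow> i < n \<Longrightarrow>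
         dist ((f ^^ ((\<Sum>l=1..j-1. n + N) + i)) p) ((f ^^ i) (x (j - 1))) < e"
      by blast
    then show "\<exists>p. \<forall>j<L. \<forall>i<n. dist ((f ^^ (j * (n + N) + i)) p) ((f ^^ i) (x j)) < e"
      by (intro exI[of _ p] allI impI) (use p[of "Suc _"] in \<open>simp add: Suc_le_eq\<close>)
  qed
qed

text \<open>Shadowing the whole forward orbit of \<open>y\<close> within \<open>\<rho>\<close> forces the orbit to land on \<open>y\<close> exactly.\<close>

lemma exact_landing:
  assumes "e > 0" "e \<le> \<rho>"
  obtains N where "\<And>x m y. \<exists>z. (\<forall>i<m. dist ((f ^^ i) z) ((f ^^ i) x) \<le> e) \<and> (f ^^ (m + N)) z = y"
proof -
  obtain N where N: "\<And>a b c n1 n2 n3. \<exists>p. (\<forall>i<n1. dist ((f ^^ i) p) ((f ^^ i) a) < e) \<and>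
     (\<forall>i<n2. dist ((f ^^ (n1 + N + i)) p) ((f ^^ i) b) < e) \<and>
     (\<forall>i<n3. dist ((f ^^ (n1 + N + (n2 + N) + i)) p) ((f ^^ i) c) < e)"
    using three_block_shadowing[OF assms(1)] by metis
  show ?thesis
  proof (rule that[of N])
    fix x y :: 'a and m :: nat
    \<comment> \<open>The orbit of \<open>y\<close> is followed for ever longer times
      \<open>l\<close>, in the middle block; the third block is empty.\<close>
    have "\<exists>z. (\<forall>i<m. dist ((f ^^ i) z) ((f ^^ i) x) < e) \<and>
        (\<forall>i<l. dist ((f ^^ (m + N + i)) z) ((f ^^ i) y) < e)" for l
      using N[of m x l y 0 y] by blast
    then obtain Z where Z: "\<And>l i. i < m \<Longrightarrow> dist ((f ^^ i) (Z l)) ((f ^^ i) x) < e"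
       "\<And>l i. i < l \<Longrightarrow> dist ((f ^^ (m + N + i)) (Z l)) ((f ^^ i) y) < e" by metis
    obtain r z where r: "strict_mono (r :: nat \<Rightarrow> nat)" "(\<lambda>k. Z (r k)) \<longlonglongrightarrow> z"
      by (rule convergent_subsequence)
    have ge: "k \<le> r k" for k using seq_suble[OF r(1)] .
    have "dist ((f ^^ i) z) ((f ^^ i) x) \<le> e" if "i < m" for i
      by (rule LIMSEQ_le_const2[OF tendsto_dist[OF tendsto_funpow[OF r(2)] tendsto_const]])
        (use Z(1)[OF that] in \<open>auto intro: less_imp_le\<close>)
    moreover have "(f ^^ (m + N)) z = y"
    proof (rule expansive_eq)
      fix n
      have "dist ((f ^^ (m + N + n)) z) ((f ^^ n) y) \<le> e"
        by (rule LIMSEQ_le_const2[OF tendsto_dist[OF tendsto_funpow[OF r(2)] tendsto_const]])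
          (intro exI[of _ "Suc n"] allI impI less_imp_le Z(2), use ge in \<open>meson Suc_le_lessD le_trans\<close>)
      then show "dist ((f ^^ n) ((f ^^ (m + N)) z)) ((f ^^ n) y) \<le> \<rho>"
        using assms(2) by (simp add: funpow_add[symmetric] add.commute flip: comp_apply[of "f ^^ n"])
    qed
    ultimately show "\<exists>z. (\<forall>i<m. dist ((f ^^ i) z) ((f ^^ i) x) \<le> e) \<and> (f ^^ (m + N)) z = y"
      by blast
  qed
qed

text \<open>The states at time \<open>m\<close>, when the gap of length \<open>N\<close> begins, of
  orbits that follow \<open>x\<close> until then and hit \<open>y\<close> at its end. Recording this
  state instead of the starting point \<open>z\<close> makes the separation depend on
  \<open>N\<close> alone and lets pasts of different lengths be compared.\<close>

definition landing :: "real \<Rightarrow> nat \<Rightarrow> 'a \<Rightarrow> nat \<Rightarrow> 'a \<Rightarrow> 'a set" where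
  "landing e N x m y =
     (f ^^ m) ` {z. (\<forall>i<m. dist ((f ^^ i) z) ((f ^^ i) x) \<le> e) \<and> (f ^^ (m + N)) z = y}"

text \<open>From time \<open>N\<close> on both orbits coincide with that of \<open>y\<close>, so
  expansivity has to tell \<open>w\<close> and \<open>w'\<close> apart within the gap, whatever
  their pasts.\<close>

lemma landing_separated:
  assumes "w \<in> landing e N x m y" "w' \<in> landing e N x' m' y" "w \<noteq> w'"
  shows "\<exists>i<N. dist ((f ^^ i) w) ((f ^^ i) w') > \<rho>"
proof -
  have y: "(f ^^ N) w = y" "(f ^^ N) w' = y"
    using assms(1,2) by (auto simp: landing_def add.commute[of _ N] funpow_add)
  obtain i where i: "dist ((f ^^ i) w) ((f ^^ i) w') > \<rho>"
    using expansive[OF assms(3)] by blast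
  have "i < N"
  proof (rule ccontr)
    assume "\<not> i < N"
    then have "f ^^ i = (f ^^ (i - N)) \<circ> (f ^^ N)"
      by (simp flip: funpow_add)
    then show False using i y rho_pos by simp
  qed
  with i show ?thesis by blast
qed

lemma finite_landing: "finite (landing e N x m y)"
proof -
  have "separated f N \<rho> (landing e N x m y)"
    unfolding separated_def using landing_separated rho_pos
    by (simp add: dn_gt_iff)
  then show ?thesis
    using separated_bounded[OF rho_pos] by metis
qed

text \<open>Forgetting the first \<open>j\<close> steps of the past only drops constraints;
  \<open>(f ^^ j) z\<close> replaces the witness \<open>z\<close>.\<close>

lemma landing_mono: "landing e N x (j + m) y \<subseteq> landing e N ((f ^^ j) x) m y"
proof
  fix w assume "w \<in> landing e N x (j + m) y"
  then obtain z where z: "\<And>i. i < j + m \<Longrightarrow> dist ((f ^^ i) z) ((f ^^ i) x) \<le> e"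
      "(f ^^ (j + m + N)) z = y" "w = (f ^^ (j + m)) z"
    by (auto simp: landing_def)
  have "\<forall>i<m. dist ((f ^^ i) ((f ^^ j) z)) ((f ^^ i) ((f ^^ j) x)) \<le> e"
    using z(1)[of "_ + j"] by (simp add: funpow_add)
  moreover have "(f ^^ (m + N)) ((f ^^ j) z) = y" "w = (f ^^ m) ((f ^^ j) z)"
    using z(2,3) by (simp_all add: add.commute[of j] add.assoc add.left_commute[of j] funpow_add)
  ultimately show "w \<in> landing e N ((f ^^ j) x) m y"
    unfolding landing_def by blast
qed

text \<open>Landing is a closed condition: if the claim failed at every scale
  \<open>1 / Suc k\<close>, a limit point of the witnesses \<open>Z k\<close> would give a landing
  point for \<open>x0\<close> and \<open>y0\<close> that some of the \<open>Q k\<close>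
  approach.\<close>

lemma landing_upper_semicontinuous:
  assumes "d' > 0"
  obtains d where "d > 0"
    "\<And>x y w. dist x x0 < d \<Longrightarrow> dist y y0 < d \<Longrightarrow> w \<in> landing e N x m y \<Longrightarrow>
       \<exists>w0 \<in> landing e N x0 m y0. dist w w0 < d'"
proof (rule ccontr)
  assume contra: "\<not> thesis"
  have "\<exists>x y w. dist x x0 < 1 / Suc k \<and> dist y y0 < 1 / Suc k \<and> w \<in> landing e N x m y \<and>
     (\<forall>w0\<in>landing e N x0 m y0. d' \<le> dist w w0)" for k
  proof (rule ccontr)
    assume neg: "\<not> ?thesis"
    have thesis
      by (rule that[of "1 / Suc k"]) (simp, use neg in \<open>meson not_le\<close>)
    with contra show False ..
  qed
  then obtain X Y Q where XYQ: "\<And>k. dist (X k) x0 < 1 / Suc k" "\<And>k. dist (Y k) y0 < 1 / Suc k"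
     "\<And>k. Q k \<in> landing e N (X k) m (Y k)"
     "\<And>k w0. w0 \<in> landing e N x0 m y0 \<Longrightarrow> d' \<le> dist (Q k) w0" by metis
  have X: "X \<longlonglongrightarrow> x0" and Y: "Y \<longlonglongrightarrow> y0"
    unfolding tendsto_dist_iff[of X] tendsto_dist_iff[of Y] using XYQ(1,2)
    by (intro tendsto_sandwich[OF _ _ tendsto_const LIMSEQ_inverse_real_of_nat]
        always_eventually allI; simp add: inverse_eq_divide less_imp_le)+
  from XYQ(3) have "\<forall>k. \<exists>z. (\<forall>i<m. dist ((f ^^ i) z) ((f ^^ i) (X k)) \<le> e) \<and>
      (f ^^ (m + N)) z = Y k \<and> Q k = (f ^^ m) z"
    unfolding landing_def by blast
  then obtain Z where Z: "\<And>k i. i < m \<Longrightarrow> dist ((f ^^ i) (Z k)) ((f ^^ i) (X k)) \<le> e"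
     "\<And>k. (f ^^ (m + N)) (Z k) = Y k" "\<And>k. Q k = (f ^^ m) (Z k)" by metis
  obtain r z where r: "strict_mono (r :: nat \<Rightarrow> nat)" "(\<lambda>k. Z (r k)) \<longlonglongrightarrow> z"
    by (rule convergent_subsequence)
  have X': "(\<lambda>k. X (r k)) \<longlonglongrightarrow> x0" and Y': "(\<lambda>k. Y (r k)) \<longlonglongrightarrow> y0"
    using LIMSEQ_subseq_LIMSEQ[OF X r(1)] LIMSEQ_subseq_LIMSEQ[OF Y r(1)] by (auto simp: o_def)
  have "dist ((f ^^ i) z) ((f ^^ i) x0) \<le> e" if "i < m" for i
    by (rule LIMSEQ_le_const2[OF tendsto_dist[OF tendsto_funpow[OF r(2)] tendsto_funpow[OF X']]])
      (use Z(1)[OF that] in auto)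
  moreover have "(f ^^ (m + N)) z = y0"
    using LIMSEQ_unique[OF tendsto_funpow[OF r(2), of "m + N"]] Y' by (simp add: Z(2))
  ultimately have "(f ^^ m) z \<in> landing e N x0 m y0"
    unfolding landing_def by blast
  then have "\<And>k. d' \<le> dist ((f ^^ m) (Z (r k))) ((f ^^ m) z)"
    using XYQ(4) Z(3) by metis
  then have "d' \<le> dist ((f ^^ m) z) ((f ^^ m) z)"
    by (intro LIMSEQ_le_const[OF tendsto_dist[OF tendsto_funpow[OF r(2)] tendsto_const]]) auto
  then show False using assms by simp
qed

text \<open>Bertrand's synchronisation argument: where the number of landing points is minimal, no landing
  point can be lost by prolonging the past or perturbing the future, so one of them serves all
  nearby pasts and futures.\<close>

lemma synchronizing_landing:
  assumes "e > 0" "e \<le> \<rho>"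
  obtains N m0 x0 y0 w0 d where "d > 0"
    "\<And>x j y. dist ((f ^^ j) x) x0 < d \<Longrightarrow> dist y y0 < d \<Longrightarrow>
      \<exists>z. (\<forall>i<j + m0. dist ((f ^^ i) z) ((f ^^ i) x) \<le> e) \<and> (f ^^ (j + m0 + N)) z = y \<and>
        (\<forall>i<N. dist ((f ^^ (j + m0 + i)) z) ((f ^^ i) w0) \<le> \<rho> / 2)"
proof -
  obtain N where N: "\<And>x m y. \<exists>z. (\<forall>i<m. dist ((f ^^ i) z) ((f ^^ i) x) \<le> e) \<and> (f ^^ (m + N)) z = y"
    using exact_landing[OF assms] by metis
  have ne: "landing e N x m y \<noteq> {}" for x m y
    using N[of m x y] unfolding landing_def by blast
  \<comment> \<open>The minimum over all pasts, lengths and futures at once.\<close>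
  define k where "k = (LEAST k. \<exists>x m y. card (landing e N x m y) = k)"
  have "\<exists>x m y. card (landing e N x m y) = k"
    unfolding k_def by (rule LeastI_ex) blast
  then obtain x0 m0 y0 where k: "card (landing e N x0 m0 y0) = k" by blast
  have k_le: "k \<le> card (landing e N x m y)" for x m y
    unfolding k_def by (rule Least_le) blast
  obtain w0 where w0: "w0 \<in> landing e N x0 m0 y0" using ne by blast
  \<comment> \<open>Points closer than \<open>d'\<close> stay within \<rho>/2 during the gap, so two
    landing points with the same future, which part by more than \<rho>, cannot have the same image
    under \<open>h\<close>.\<close>
  obtain d' where d': "d' > 0" "\<And>x y. dist x y < d' \<Longrightarrow> dn f N x y < \<rho> / 2"
    using dn_uniform[of "\<rho> / 2" N] rho_pos by auto
  obtain d where d: "d > 0"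
    "\<And>x y w. dist x x0 < d \<Longrightarrow> dist y y0 < d \<Longrightarrow> w \<in> landing e N x m0 y \<Longrightarrow>
       \<exists>w0 \<in> landing e N x0 m0 y0. dist w w0 < d'"
    using landing_upper_semicontinuous[OF d'(1), of x0 y0 e N m0] by metis
  show ?thesis
  proof (rule that[OF d(1)])
    fix x y j assume xy: "dist ((f ^^ j) x) x0 < d" "dist y y0 < d"
    let ?A = "landing e N x (j + m0) y" and ?B = "landing e N x0 m0 y0"
    have "\<forall>w\<in>?A. \<exists>w'\<in>?B. dist w w' < d'"
      using d(2)[OF xy] landing_mono by blast
    then obtain h where h: "\<And>w. w \<in> ?A \<Longrightarrow> h w \<in> ?B" "\<And>w. w \<in> ?A \<Longrightarrow> dist w (h w) < d'"
      by metis
    have "inj_on h ?A"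
    proof (rule inj_onI, rule ccontr)
      fix w w' assume w: "w \<in> ?A" "w' \<in> ?A" "h w = h w'" "w \<noteq> w'"
      then obtain i where i: "i < N" "dist ((f ^^ i) w) ((f ^^ i) w') > \<rho>"
        using landing_separated by blast
      have "dist ((f ^^ i) w) ((f ^^ i) w') \<le> dn f N w w'"
        by (rule dist_funpow_le_dn[OF i(1)])
      also have "\<dots> \<le> dn f N w (h w) + dn f N w' (h w')"
        using dn_triangle[of f N w w' "h w"] w(3) by (simp add: dn_commute)
      also have "\<dots> < \<rho>"
        using d'(2)[OF h(2)[OF w(1)]] d'(2)[OF h(2)[OF w(2)]] by simp
      finally show False using i(2) by simp
    qed
    \<comment> \<open>By minimality \<open>?A\<close> has at least as many points as
      \<open>?B\<close>, so the injection \<open>h\<close> is onto, and \<open>w0\<close> is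
      approached for every admissible past and future.\<close>
    then have "card (h ` ?A) \<ge> card ?B"
      using k_le[of x "j + m0" y] k by (simp add: card_image)
    then have "h ` ?A = ?B"
      using h(1) finite_landing by (intro card_seteq) auto
    with w0 have "w0 \<in> h ` ?A" by simp
    then obtain w where w: "w \<in> ?A" "h w = w0" by (elim imageE) simp
    obtain z where z: "\<And>i. i < j + m0 \<Longrightarrow> dist ((f ^^ i) z) ((f ^^ i) x) \<le> e"
        "(f ^^ (j + m0 + N)) z = y" "w = (f ^^ (j + m0)) z"
      using w(1) unfolding landing_def by blast
    have "(f ^^ (j + m0 + i)) z = (f ^^ i) w" for i
      by (simp add: z(3) funpow_add[of i "j + m0" f, unfolded comp_def, THEN fun_cong, symmetric] add.commute)
    then
    have "dist ((f ^^ (j + m0 + i)) z) ((f ^^ i) w0) \<le> \<rho> / 2" if "i < N" for i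
      using dist_funpow_le_dn[OF that, of f w w0] d'(2)[OF h(2)[OF w(1)]] w(2) by simp
    with z show "\<exists>z. (\<forall>i<j + m0. dist ((f ^^ i) z) ((f ^^ i) x) \<le> e) \<and> (f ^^ (j + m0 + N)) z = y \<and>
        (\<forall>i<N. dist ((f ^^ (j + m0 + i)) z) ((f ^^ i) w0) \<le> \<rho> / 2)" by blast
  qed
qed

text \<open>The synchronised crossing gives an inverse branch of \<open>f ^^ M\<close>,
  \<open>M = n + G\<close>, that maps a ball about \<open>y0\<close> into itself. Successive
  backward iterates stay \<rho>-close for ever longer times, so by expansivity their limit is a
  fixed point of \<open>f ^^ M\<close>.\<close>

lemma periodic_shadowing:
  assumes "e > 0"
  obtains G t where "t \<le> G" "G > 0"
    "\<And>x n. \<exists>p. (f ^^ (n + G)) p = p \<and> (\<forall>i<n. dist ((f ^^ (t + i)) p) ((f ^^ i) x) \<le> e)"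
proof -
  \<comment> \<open>Two errors of size \<open>e'\<close> will be added; their sum must exceed
    neither \<open>e\<close> nor \<rho>.\<close>
  define e' where "e' = min (e / 2) (\<rho> / 2)"
  have e': "e' > 0" "e' \<le> \<rho>" "2 * e' \<le> \<rho>" "2 * e' \<le> e"
    using assms rho_pos by (auto simp: e'_def)
  obtain N m0 x0 y0 w0 d where d: "d > 0"
    and sync: "\<And>x j y. dist ((f ^^ j) x) x0 < d \<Longrightarrow> dist y y0 < d \<Longrightarrow>
      \<exists>z. (\<forall>i<j + m0. dist ((f ^^ i) z) ((f ^^ i) x) \<le> e') \<and> (f ^^ (j + m0 + N)) z = y \<and>
        (\<forall>i<N. dist ((f ^^ (j + m0 + i)) z) ((f ^^ i) w0) \<le> \<rho> / 2)"
    using synchronizing_landing[OF e'(1,2)] by metis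
  obtain l where l: "\<And>x y. (\<And>i. i < l \<Longrightarrow> dist ((f ^^ i) x) ((f ^^ i) y) \<le> \<rho>) \<Longrightarrow> dist x y < d"
    using uniform_expansive[OF d] by metis
  obtain K where K: "\<And>a b c n1 n2 n3. \<exists>p. (\<forall>i<n1. dist ((f ^^ i) p) ((f ^^ i) a) < e') \<and>
     (\<forall>i<n2. dist ((f ^^ (n1 + K + i)) p) ((f ^^ i) b) < e') \<and>
     (\<forall>i<n3. dist ((f ^^ (n1 + K + (n2 + K) + i)) p) ((f ^^ i) c) < e')"
    using three_block_shadowing[OF e'(1)] by metis
  define t where "t = l + K"
  define G where "G = Suc (l + K + K + m0 + N)"
  show ?thesis
  proof (rule that[of t G])
    show "t \<le> G" "G > 0" by (auto simp: t_def G_def)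
    fix x :: 'a and n :: nat
    \<comment> \<open>The orbit of \<open>q\<close> follows \<open>y0\<close> for \<open>l\<close>
      steps, which forces pulled back points into the ball about \<open>y0\<close>; then
      \<open>x\<close>; then \<open>x0\<close> for \<open>l\<close> steps, so that synchronisation
      applies at time \<open>j\<close>. The extra step in \<open>n + 1\<close> keeps
      \<open>G\<close> positive.\<close>
    define j where "j = l + K + (n + 1 + K)"
    define M where "M = j + m0 + N"
    have M: "M = n + G" by (simp add: M_def j_def G_def)
    obtain q where q: "\<And>i. i < l \<Longrightarrow> dist ((f ^^ i) q) ((f ^^ i) y0) < e'"
      "\<And>i. i < n + 1 \<Longrightarrow> dist ((f ^^ (l + K + i)) q) ((f ^^ i) x) < e'"
      "\<And>i. i < l \<Longrightarrow> dist ((f ^^ (j + i)) q) ((f ^^ i) x0) < e'"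
      using K[of l y0 "n + 1" x l x0] unfolding j_def by blast
    have qx0: "dist ((f ^^ j) q) x0 < d"
      by (rule l) (use q(3) e'(2) in \<open>fastforce simp: funpow_add add.commute\<close>)
    define pull where "pull y = (SOME z. (\<forall>i<j + m0. dist ((f ^^ i) z) ((f ^^ i) q) \<le> e') \<and>
        (f ^^ (j + m0 + N)) z = y \<and> (\<forall>i<N. dist ((f ^^ (j + m0 + i)) z) ((f ^^ i) w0) \<le> \<rho> / 2))" for y
    have pull: "\<And>i. i < j + m0 \<Longrightarrow> dist ((f ^^ i) (pull y)) ((f ^^ i) q) \<le> e'"
       "(f ^^ M) (pull y) = y"
       "\<And>i. i < N \<Longrightarrow> dist ((f ^^ (j + m0 + i)) (pull y)) ((f ^^ i) w0) \<le> \<rho> / 2"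
      if "dist y y0 < d" for y
      using someI_ex[OF sync[OF qx0 that]] unfolding pull_def M_def by blast+
    have pull_near: "dist (pull y) y0 < d" if y: "dist y y0 < d" for y
    proof (rule l)
      fix i assume i: "i < l"
      then show "dist ((f ^^ i) (pull y)) ((f ^^ i) y0) \<le> \<rho>"
        using q(1)[OF i] pull(1)[OF y, of i] e'(3)
          dist_triangle[of "(f ^^ i) (pull y)" "(f ^^ i) y0" "(f ^^ i) q"]
        by (simp add: j_def)
    qed
    define Y where "Y k = (pull ^^ k) y0" for k
    have Y_near: "dist (Y k) y0 < d" for k
      by (induction k) (simp_all add: Y_def d pull_near)
    have Y_Suc: "Y (Suc k) = pull (Y k)" for k by (simp add: Y_def)
    \<comment> \<open>All pulled back points follow the same \<open>q\<close> and then, across the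
      gap, the same \<open>w0\<close>; this is the use of the common landing point.\<close>
    have close: "dist ((f ^^ i) (pull y)) ((f ^^ i) (pull y')) \<le> \<rho>"
      if y: "dist y y0 < d" "dist y' y0 < d" and i: "i < M" for y y' i
    proof (cases "i < j + m0")
      case True
      then show ?thesis
        using pull(1)[OF y(1) True] pull(1)[OF y(2) True] e'(3)
          dist_triangle2[of "(f ^^ i) (pull y)" "(f ^^ i) (pull y')" "(f ^^ i) q"] by linarith
    next
      case False
      define i' where "i' = i - (j + m0)"
      have i': "i = j + m0 + i'" "i' < N" using False i by (auto simp: i'_def M_def)
      show ?thesis
        using pull(3)[OF y(1) i'(2)] pull(3)[OF y(2) i'(2)] unfolding i'(1)
          using dist_triangle2[of "(f ^^ (j + m0 + i')) (pull y)" "(f ^^ (j + m0 + i')) (pull y')" "(f ^^ i') w0"]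
          by linarith
    qed
    \<comment> \<open>Each \<open>pull\<close> prepends \<open>M\<close> steps covered by
      \<open>close\<close>; afterwards \<open>f ^^ M\<close> leads back to the previous
      pair.\<close>
    have contract: "dist ((f ^^ i) (Y k)) ((f ^^ i) (Y (Suc k))) \<le> \<rho>" if "i < k * M" for i k
      using that
    proof (induction k arbitrary: i)
      case (Suc k)
      show ?case
      proof (cases "i < M")
        case True
        then show ?thesis unfolding Y_Suc[of k] Y_Suc[of "Suc k"]
          using close Y_near pull_near by (metis Y_Suc)
      next
        case False
        then have "f ^^ i = (f ^^ (i - M)) \<circ> (f ^^ M)"
          by (simp flip: funpow_add)
        moreover have "(f ^^ M) (Y (Suc k)) = Y k" for k
          using pull(2)[OF Y_near] Y_Suc by simp
        ultimately show ?thesis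
          using Suc.IH[of "i - M"] Suc.prems False by auto
      qed
    qed simp
    have "M > 0" by (simp add: M G_def)
    \<comment> \<open>Along a common subsequence, \<open>p\<close> is the limit of the iterates and
      \<open>p'\<close> that of their successors.\<close>
    obtain r p where r: "strict_mono (r :: nat \<Rightarrow> nat)" "(\<lambda>k. Y (r k)) \<longlonglongrightarrow> p"
      by (rule convergent_subsequence)
    obtain r' p' where r': "strict_mono (r' :: nat \<Rightarrow> nat)" "(\<lambda>k. Y (Suc (r (r' k)))) \<longlonglongrightarrow> p'"
      using convergent_subsequence[of "\<lambda>k. Y (Suc (r k))"] by metis
    have p: "(\<lambda>k. Y (r (r' k))) \<longlonglongrightarrow> p"
      using LIMSEQ_subseq_LIMSEQ[OF r(2) r'(1)] by (simp add: o_def)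
    have ge: "k \<le> r (r' k)" for k
      using seq_suble[OF r'(1), of k] seq_suble[OF r(1), of "r' k"] by simp
    have "p = p'"
    proof (rule expansive_eq)
      fix i
      show "dist ((f ^^ i) p) ((f ^^ i) p') \<le> \<rho>"
      proof (rule LIMSEQ_le_const2[OF tendsto_dist[OF tendsto_funpow[OF p] tendsto_funpow[OF r'(2)]]])
        have "i < r (r' k) * M" if "Suc i \<le> k" for k
        proof -
          have "Suc i * 1 \<le> r (r' k) * M"
            using that ge[of k] \<open>M > 0\<close> by (intro mult_le_mono) auto
          then show ?thesis by simp
        qed
        then show "\<exists>N. \<forall>k\<ge>N. dist ((f ^^ i) (Y (r (r' k)))) ((f ^^ i) (Y (Suc (r (r' k))))) \<le> \<rho>"
          using contract by blast
      qed
    qed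
    have "(f ^^ M) p' = p"
      using LIMSEQ_unique[OF tendsto_funpow[OF r'(2), of M]] p pull(2)[OF Y_near] by (simp add: Y_Suc)
    with \<open>p = p'\<close> have per: "(f ^^ (n + G)) p = p" by (simp add: M)
    have "dist ((f ^^ (t + i)) p) ((f ^^ i) x) \<le> e" if i: "i < n" for i
    proof -
      have "dist ((f ^^ (t + i)) p') ((f ^^ (t + i)) q) \<le> e'"
      proof (rule LIMSEQ_le_const2[OF tendsto_dist[OF tendsto_funpow[OF r'(2)] tendsto_const]])
        have "t + i < j + m0" using i by (simp add: t_def j_def)
        then show "\<exists>N. \<forall>k\<ge>N. dist ((f ^^ (t + i)) (Y (Suc (r (r' k))))) ((f ^^ (t + i)) q) \<le> e'"
          using pull(1)[OF Y_near] by (simp add: Y_Suc)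
      qed
      moreover have "dist ((f ^^ (t + i)) q) ((f ^^ i) x) < e'"
        using q(2)[of i] i by (simp add: t_def)
      ultimately show ?thesis
        using e'(4) \<open>p = p'\<close> dist_triangle[of "(f ^^ (t + i)) p" "(f ^^ i) x" "(f ^^ (t + i)) q"]
        by simp
    qed
    with per show "\<exists>p. (f ^^ (n + G)) p = p \<and> (\<forall>i<n. dist ((f ^^ (t + i)) p) ((f ^^ i) x) \<le> e)"
      by blast
  qed
qed

end

subsection \<open>Covering the periodic measures\<close>

text \<open>\<open>measure_pmf\<close> carries the power set as sigma-algebra; this moves a discrete
  law to the Borel sets, as \<open>prob_measures\<close> demands.\<close>

definition pmf_borel :: "'a::topological_space pmf \<Rightarrow> 'a measure" where
  "pmf_borel P = distr (measure_pmf P) borel (\<lambda>x. x)"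

lemma pmf_borel_map: "pmf_borel (map_pmf g P) = distr (measure_pmf P) borel g"
  unfolding pmf_borel_def map_pmf_rep_eq by (subst distr_distr) (auto simp: comp_def)

lemma pmf_borel_in_prob_measures: "pmf_borel P \<in> prob_measures"
  unfolding pmf_borel_def prob_measures_def by (auto intro!: measure_pmf.prob_space_distr)

text \<open>Makes a joint discrete law an admissible transport plan, so that its expected cost
  bounds \<open>W1n\<close>.\<close>

lemma pmf_coupling:
  fixes Q :: "('a::metric_space \<times> 'a) pmf"
  shows "pmf_borel Q \<in> couplings (pmf_borel (map_pmf fst Q)) (pmf_borel (map_pmf snd Q))"
proof -
  have "fst \<in> borel_measurable (borel :: ('a \<times> 'a) measure)"
    "snd \<in> borel_measurable (borel :: ('a \<times> 'a) measure)"
    by (auto intro!: borel_measurable_continuous_onI continuous_intros)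
  then have "distr (pmf_borel Q) borel fst = pmf_borel (map_pmf fst Q)"
    "distr (pmf_borel Q) borel snd = pmf_borel (map_pmf snd Q)"
    unfolding pmf_borel_map by (auto simp: pmf_borel_def distr_distr comp_def)
  then show ?thesis
    using pmf_borel_in_prob_measures[of Q] by (simp add: couplings_def prob_measures_def)
qed

text \<open>Singletons are closed, hence Borel, and the point masses on \<open>F\<close>, which add
  up to 1, determine the measure.\<close>

lemma finitely_supported_measure_is_pmf:
  fixes \<mu> :: "'a::t1_space measure"
  assumes "\<mu> \<in> prob_measures" "finite F" "measure \<mu> F = 1"
  obtains P where "set_pmf P \<subseteq> F" "\<mu> = pmf_borel P"
proof -
  interpret prob_space \<mu> using assms(1) by (simp add: prob_measures_def)
  have sets: "sets \<mu> = sets borel" using assms(1) by (simp add: prob_measures_def)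
  have fin: "A \<in> sets \<mu>" if "finite A" for A
    using that by (simp add: sets finite_imp_closed)
  define w where "w x = (if x \<in> F then measure \<mu> {x} else 0)" for x
  have sum_w: "(\<Sum>x\<in>A. w x) = measure \<mu> A" if "A \<subseteq> F" for A
  proof -
    have A: "finite A" using that assms(2) finite_subset by blast
    have "measure \<mu> (\<Union>x\<in>A. {x}) = (\<Sum>x\<in>A. measure \<mu> {x})"
      by (rule finite_measure_finite_Union) (auto simp: A fin disjoint_family_on_def)
    then show ?thesis using that by (auto simp: w_def intro!: sum.cong)
  qed
  have nn: "\<And>x. 0 \<le> w x" by (simp add: w_def)
  have "(\<integral>\<^sup>+x. ennreal (w x) \<partial>count_space UNIV) = (\<Sum>x\<in>F. ennreal (w x))"
    using assms(2) by (intro nn_integral_count_space') (auto simp: w_def)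
  also have "\<dots> = 1"
    using sum_w[of F] assms(3) by (simp add: nn sum_ennreal)
  finally have one: "(\<integral>\<^sup>+x. ennreal (w x) \<partial>count_space UNIV) = 1" .
  define P where "P = embed_pmf w"
  have P: "pmf P x = w x" for x
    unfolding P_def by (rule pmf_embed_pmf[OF nn one])
  have sub: "set_pmf P \<subseteq> F"
    by (auto simp: set_pmf_eq P w_def split: if_splits)
  have "\<mu> = pmf_borel P"
  proof (rule measure_eqI)
    show "sets \<mu> = sets (pmf_borel P)" by (simp add: sets pmf_borel_def)
    fix A assume A: "A \<in> sets \<mu>"
    have "measure \<mu> A = measure \<mu> (A \<inter> F)"
    proof (rule measure_eq_AE)
      have "AE x in \<mu>. x \<in> F"
        using assms(3) fin[OF assms(2)] prob_eq_1 by auto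
      then show "AE x in \<mu>. (x \<in> A) = (x \<in> A \<inter> F)" by auto
    qed (use A fin assms(2) in auto)
    also have "\<dots> = (\<Sum>x\<in>A \<inter> F. pmf P x)" by (simp add: P sum_w)
    also have "\<dots> = measure (measure_pmf P) (A \<inter> F)"
      using assms(2) by (subst measure_measure_pmf_finite) auto
    also have "\<dots> = measure (measure_pmf P) A"
      using measure_Int_set_pmf[of P A] measure_Int_set_pmf[of P "A \<inter> F"] sub
      by (simp add: Int_assoc inf.absorb2)
    finally show "emeasure \<mu> A = emeasure (pmf_borel P) A"
      using A sets by (simp add: emeasure_eq_measure pmf_borel_def emeasure_distr
          measure_pmf.emeasure_eq_measure)
  qed
  with sub show ?thesis by (rule that)
qed

lemma finite_periodic_orbit:
  assumes "k > 0" "(f ^^ k) p = p"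
  shows "finite (range (\<lambda>i. (f ^^ i) p))"
proof -
  have "(f ^^ i) p = (f ^^ (i mod k)) p" for i
  proof -
    have "((f ^^ k) ^^ m) p = p" for m by (induction m) (simp_all add: assms(2))
    then have per: "(f ^^ (k * m)) p = p" for m by (simp add: funpow_mult)
    have "(f ^^ i) p = (f ^^ (i mod k + k * (i div k))) p" by simp
    also have "\<dots> = (f ^^ (i mod k)) p" by (simp only: funpow_add comp_apply per)
    finally show ?thesis .
  qed
  then have "range (\<lambda>i. (f ^^ i) p) \<subseteq> (\<lambda>i. (f ^^ i) p) ` {..<k}"
    using assms(1) by (metis (mono_tags, lifting) image_eqI image_subsetI lessThan_iff mod_less_divisor)
  then show ?thesis by (rule finite_subset) simp
qed

lemma periodic_measure_is_pmf:
  fixes f :: "'a::t1_space \<Rightarrow> 'a"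
  assumes "\<mu> \<in> periodic_measures f"
  obtains P where "finite (set_pmf P)" "\<mu> = pmf_borel P"
proof -
  obtain p k where "k > 0" "(f ^^ k) p = p" "measure \<mu> (range (\<lambda>i. (f ^^ i) p)) = 1"
      "\<mu> \<in> prob_measures"
    using assms by (auto simp: periodic_measures_def ergodic_measure_def invariant_measure_def)
  then show ?thesis
    using finitely_supported_measure_is_pmf[of \<mu> "range (\<lambda>i. (f ^^ i) p)"] finite_periodic_orbit[of k f p] that
    by (metis finite_subset)
qed

section \<open>Transport costs and separation numbers\<close>

context compact_system begin

lemma bdd_below_coupling_costs:
  "bdd_below ((\<lambda>\<pi>. integral\<^sup>L \<pi> (\<lambda>(x, y). dn f n x y)) ` couplings \<mu> \<nu>)"
  by (rule bdd_belowI[of _ 0]) (auto intro!: Bochner_Integration.integral_nonneg simp: dn_nonneg split_beta)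

lemma dn_borel_measurable: "(\<lambda>(x, y). dn f n x y) \<in> borel_measurable borel"
  using borel_measurable_continuous_onI[OF continuous_dn[of n]] by (simp add: case_prod_beta)

lemma W1n_pmf_le:
  "W1n f n (pmf_borel (map_pmf fst Q)) (pmf_borel (map_pmf snd Q))
     \<le> measure_pmf.expectation Q (\<lambda>(x, y). dn f n x y)"
proof -
  have "W1n f n (pmf_borel (map_pmf fst Q)) (pmf_borel (map_pmf snd Q))
     \<le> integral\<^sup>L (pmf_borel Q) (\<lambda>(x, y). dn f n x y)"
    unfolding W1n_def by (rule cInf_lower[OF imageI[OF pmf_coupling] bdd_below_coupling_costs])
  also have "\<dots> = measure_pmf.expectation Q (\<lambda>(x, y). dn f n x y)"
    unfolding pmf_borel_def using dn_borel_measurable[of n] by (subst integral_distr) auto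
  finally show ?thesis .
qed

lemma sep_num_bdd: "e > 0 \<Longrightarrow> bdd_above {card E | E. finite E \<and> separated f n e E}"
  using separated_bounded[of e n] by (smt (verit) bdd_aboveI mem_Collect_eq)

lemma sep_num_ge:
  assumes "e > 0" "separated f n e E"
  shows "card E \<le> sep_num f n e"
  unfolding sep_num_def
  by (rule cSup_upper[OF _ sep_num_bdd[OF assms(1)]])
    (use separated_bounded[OF assms(1), of n] assms(2) in blast)

text \<open>The compactness bound makes the set of cardinalities finite, so its supremum in
  \<open>nat\<close> is a maximum.\<close>

lemma sep_num_attained:
  assumes "e > 0"
  obtains E where "finite E" "separated f n e E" "card E = sep_num f n e"
proof -
  let ?S = "{card E | E. finite E \<and> separated f n e E}"
  have ne: "?S \<noteq> {}" by (auto intro!: exI[of _ "{}"] simp: separated_def)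
  have "finite ?S" using sep_num_bdd[OF assms] by (simp add: bdd_above_nat)
  then have "Max ?S \<in> ?S" using ne by (rule Max_in)
  moreover have "Sup ?S = Max ?S" using ne by (simp only: Sup_nat_def if_False)
  ultimately have "Sup ?S \<in> ?S" by (simp only:)
  then show ?thesis
    using that unfolding sep_num_def by auto
qed

lemma sep_num_pos: "e > 0 \<Longrightarrow> 1 \<le> sep_num f n e"
  using sep_num_ge[of e n "{undefined}"] by (simp add: separated_def)

lemma sep_num_antimono:
  assumes "0 < e" "e \<le> e'"
  shows "sep_num f n e' \<le> sep_num f n e"
proof -
  obtain E where E: "separated f n e' E" "card E = sep_num f n e'"
    using sep_num_attained[of e' n] assms by auto
  then have "separated f n e E"
    using assms(2) unfolding separated_def by fastforce
  then show ?thesis using sep_num_ge[OF assms(1)] E(2) by metis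
qed

text \<open>A point farther than \<open>e\<close> from all of \<open>E\<close> could be added to
  \<open>E\<close>, against its maximal cardinality.\<close>

lemma maximal_separated_spans:
  assumes "e > 0" "finite E" "separated f n e E" "card E = sep_num f n e"
  shows "\<exists>y\<in>E. dn f n x y \<le> e"
proof (rule ccontr)
  assume "\<not> ?thesis"
  then have *: "\<And>y. y \<in> E \<Longrightarrow> e < dn f n x y" by force
  then have "x \<notin> E" using assms(1) by force
  have "separated f n e (insert x E)"
    using assms(3) * dn_commute[of f n] unfolding separated_def by auto
  from sep_num_ge[OF assms(1) this] \<open>x \<notin> E\<close> assms(2,4) show False by simp
qed

text \<open>Every atom at \<open>x\<close> is moved to the nearby point \<open>r x\<close> of a spanning set \<open>E\<close>; then the weights on
  \<open>E\<close> are rounded down to multiples of \<open>1/K\<close> and the remaining mass is sent to a fixed point \<open>e0\<close>.\<close>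

lemma cover_periodic_measures:
  assumes e: "e > 0" and D: "\<And>x y :: 'a. dist x y \<le> D" and K: "K > 0"
    and KD: "D * real (sep_num f n (e / 2)) / real K \<le> e / 2"
  obtains C where "finite C" "C \<subseteq> prob_measures" "card C \<le> (K + 1) ^ sep_num f n (e / 2)"
    "\<And>\<mu>. \<mu> \<in> periodic_measures f \<Longrightarrow> \<exists>\<nu>\<in>C. W1n f n \<mu> \<nu> \<le> e"
proof -
  obtain E where E: "finite E" "separated f n (e / 2) E" "card E = sep_num f n (e / 2)"
    using sep_num_attained[of "e / 2" n] e by auto
  obtain r where r: "\<And>x. r x \<in> E" "\<And>x. dn f n x (r x) \<le> e / 2"
    using maximal_separated_spans[OF _ E] e by (metis half_gt_zero)
  define e0 :: 'a where "e0 = undefined"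
  have D0: "0 \<le> D" using D[of e0 e0] by simp
  have dnD: "dn f n x y \<le> D" for x y using D by (simp add: dn_le_iff D0)
  \<comment> \<open>\<open>w\<close> is the law of \<open>r x\<close>, \<open>a\<close> the rounded
    numerators over \<open>K\<close>, and \<theta> the share of the mass at \<open>y\<close> that
    rounding keeps, which is 0 for zero mass because division by 0 gives 0.\<close>
  define w where "w P y = pmf (map_pmf r P) y" for P y
  define a where "a P y = (if y \<in> E then nat \<lfloor>real K * w P y\<rfloor> else 0)" for P y
  define \<theta> where "\<theta> P y = real (a P y) / (real K * w P y)" for P y
  \<comment> \<open>Draw \<open>x\<close>, then go to \<open>r x\<close> with probability \<theta>
    and to \<open>e0\<close> otherwise: a coupling of \<open>P\<close> with its rounded
    version.\<close>
  define Q where "Q P = bind_pmf P (\<lambda>x. map_pmf (\<lambda>b. (x, if b then r x else e0)) (bernoulli_pmf (\<theta> P (r x))))" for P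
  have w: "0 \<le> w P y" "w P y \<le> 1" for P y by (simp_all add: w_def pmf_le_1)
  have a_le: "real (a P y) \<le> real K * w P y" for P y
    using w[of P y] by (simp add: a_def)
  have a_ge: "real K * w P y - 1 \<le> real (a P y)" if "y \<in> E" for P y
    using that w[of P y] by (simp add: a_def)
  have theta: "0 \<le> \<theta> P y" "\<theta> P y \<le> 1" for P y
    using a_le[of P y] w[of P y] K by (auto simp: \<theta>_def divide_le_eq_1)
  have theta_w: "\<theta> P y * w P y = real (a P y) / real K" for P y
    using a_le[of P y] K by (cases "w P y = 0") (auto simp: \<theta>_def)
  have supp: "set_pmf (map_pmf r P) \<subseteq> E" for P using r(1) by auto
  have sum_w: "(\<Sum>y\<in>E. w P y) = 1" for P
    unfolding w_def by (rule sum_pmf_eq_1[OF E(1) supp])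
  have fst_Q: "map_pmf fst (Q P) = P" for P
    by (simp add: Q_def map_bind_pmf pmf.map_comp comp_def bind_return_pmf')
  \<comment> \<open>The second marginal depends on \<open>P\<close> only through the integers
    \<open>a P y\<close> with \<open>y\<close> in \<open>E\<close>; this is what makes the cover
    finite.\<close>
  have pmf_snd_Q: "pmf (map_pmf snd (Q P)) z =
      (\<Sum>y\<in>E. real (a P y) / real K * indicator {z} y) +
      indicator {z} e0 * (1 - (\<Sum>y\<in>E. real (a P y) / real K))" for P z
  proof -
    have "map_pmf snd (Q P) = bind_pmf (map_pmf r P)
        (\<lambda>y. map_pmf (\<lambda>b. if b then y else e0) (bernoulli_pmf (\<theta> P y)))"
      by (simp add: Q_def map_bind_pmf pmf.map_comp comp_def bind_map_pmf)
    also have "pmf \<dots> z = (\<Sum>y\<in>E. pmf (map_pmf (\<lambda>b. if b then y else e0) (bernoulli_pmf (\<theta> P y))) z * w P y)"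
      unfolding pmf_bind w_def using supp by (intro integral_measure_pmf_real E(1)) auto
    also have "\<dots> = (\<Sum>y\<in>E. real (a P y) / real K * indicator {z} y +
         indicator {z} e0 * (w P y - real (a P y) / real K))"
      by (intro sum.cong refl)
        (simp add: map_pmf_def pmf_bind theta algebra_simps flip: theta_w)
    finally show ?thesis
      by (simp add: sum.distrib sum_distrib_left[symmetric] sum_subtractf sum_w)
  qed
  \<comment> \<open>Moving to \<open>r x\<close> costs at most \<open>e / 2\<close>; each of the
    \<open>card E\<close> roundings loses mass at most \<open>1 / K\<close>, carried over a distance
    at most \<open>D\<close>.\<close>
  have cost: "measure_pmf.expectation (Q P) (\<lambda>(x, y). dn f n x y) \<le> e" if fin: "finite (set_pmf P)" for P
  proof -
    have "measure_pmf.expectation (Q P) (\<lambda>(x, y). dn f n x y) =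
       (\<Sum>x\<in>set_pmf P. pmf P x * (dn f n x (r x) * \<theta> P (r x) + dn f n x e0 * (1 - \<theta> P (r x))))"
      unfolding Q_def by (subst pmf_expectation_bind[OF fin]) (auto simp: theta)
    also have "\<dots> \<le> (\<Sum>x\<in>set_pmf P. pmf P x * (e / 2 + D * (1 - \<theta> P (r x))))"
    proof (intro sum_mono mult_left_mono add_mono)
      fix x
      show "dn f n x (r x) * \<theta> P (r x) \<le> e / 2"
        using mult_mono[OF r(2)[of x] theta(2)[of P "r x"]] e theta(1)[of P "r x"] by simp
      show "dn f n x e0 * (1 - \<theta> P (r x)) \<le> D * (1 - \<theta> P (r x))"
        using dnD theta(2) by (intro mult_right_mono) auto
    qed simp
    also have "\<dots> = measure_pmf.expectation P (\<lambda>x. e / 2 + D * (1 - \<theta> P (r x)))"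
      by (subst integral_measure_pmf_real[OF fin]) (auto simp: mult.commute)
    also have "\<dots> = measure_pmf.expectation (map_pmf r P) (\<lambda>y. e / 2 + D * (1 - \<theta> P y))"
      by simp
    also have "\<dots> = (\<Sum>y\<in>E. (e / 2 + D * (1 - \<theta> P y)) * w P y)"
      unfolding w_def using supp by (intro integral_measure_pmf_real E(1)) auto
    also have "\<dots> = (\<Sum>y\<in>E. e / 2 * w P y + D * (w P y - real (a P y) / real K))"
      by (intro sum.cong refl) (simp add: algebra_simps flip: theta_w)
    also have "\<dots> \<le> (\<Sum>y\<in>E. e / 2 * w P y + D * (1 / real K))"
    proof (intro sum_mono add_left_mono mult_left_mono D0)
      fix y assume "y \<in> E"
      from a_ge[OF this, of P] have "w P y \<le> (real (a P y) + 1) / real K"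
        using K by (simp add: pos_le_divide_eq mult.commute)
      then show "w P y - real (a P y) / real K \<le> 1 / real K"
        by (simp add: add_divide_distrib)
    qed
    also have "\<dots> = e / 2 + D * real (card E) / real K"
      by (simp only: sum.distrib sum_distrib_left[symmetric] sum_w) simp
    also have "\<dots> \<le> e" unfolding E(3) using KD by linarith
    finally show ?thesis .
  qed
  \<comment> \<open>Any law with the given rounding may represent it; vectors that no law produces
    get an arbitrary law.\<close>
  define rep where "rep b = (SOME P. restrict (a P) E = b)" for b
  define C where "C = (\<lambda>b. pmf_borel (map_pmf snd (Q (rep b)))) ` (E \<rightarrow>\<^sub>E {0..K})"
  show ?thesis
  proof (rule that[of C])
    show "finite C" unfolding C_def by (intro finite_imageI finite_PiE E(1)) auto
    show "C \<subseteq> prob_measures" by (auto simp: C_def pmf_borel_in_prob_measures)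
    have "card C \<le> card (E \<rightarrow>\<^sub>E {0..K})"
      unfolding C_def by (intro card_image_le finite_PiE E(1)) auto
    also have "\<dots> = (K + 1) ^ sep_num f n (e / 2)"
      by (simp add: card_PiE E(1,3))
    finally show "card C \<le> (K + 1) ^ sep_num f n (e / 2)" .
    fix \<mu> assume "\<mu> \<in> periodic_measures f"
    then obtain P where P: "finite (set_pmf P)" "\<mu> = pmf_borel P"
      by (rule periodic_measure_is_pmf)
    define b where "b = restrict (a P) E"
    have "a P y \<le> K" for y
    proof -
      have "real K * w P y \<le> real K" using w[of P y] by (simp add: mult_left_le)
      then have "real (a P y) \<le> real K" using a_le[of P y] by linarith
      then show ?thesis by simp
    qed
    then have "b \<in> E \<rightarrow>\<^sub>E {0..K}" by (auto simp: b_def)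
    have "restrict (a (rep b)) E = b"
      unfolding rep_def by (rule someI[of _ P]) (simp add: b_def)
    then have "a (rep b) y = a P y" if "y \<in> E" for y
      using that unfolding b_def by (metis restrict_apply')
    then have "map_pmf snd (Q (rep b)) = map_pmf snd (Q P)"
      by (intro pmf_eqI) (simp add: pmf_snd_Q)
    moreover have "W1n f n \<mu> (pmf_borel (map_pmf snd (Q P))) \<le> e"
      using W1n_pmf_le[of n "Q P"] cost[OF P(1)] by (simp add: fst_Q P(2))
    ultimately show "\<exists>\<nu>\<in>C. W1n f n \<mu> \<nu> \<le> e"
      using \<open>b \<in> _\<close> by (auto simp: C_def intro!: bexI[of _ b])
  qed
qed

section \<open>Upper bound for the covering numbers\<close>

lemma cover_num_le:
  assumes "finite C" "C \<subseteq> prob_measures" "\<And>\<mu>. \<mu> \<in> Z \<Longrightarrow> \<exists>\<nu>\<in>C. W1n f n \<mu> \<nu> \<le> e"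
  shows "cover_num f Z n e \<le> card C"
  unfolding cover_num_def by (rule wellorder_Inf_le1) (use assms in blast)

text \<open>With \<open>K\<close> of order \<open>D * S / e\<close> the cover has at most
  \<open>(K + 1) ^ S\<close> elements; the first logarithm leaves \<open>S * ln (K + 1)\<close>, the
  second \<open>ln S\<close> plus a doubly logarithmic error.\<close>

lemma ln_ln_cover_num_le:
  assumes e: "e > 0" and D: "\<And>x y :: 'a. dist x y \<le> D" "D > 0"
    and S: "ln (real (sep_num f n (e / 2))) \<le> c * real n" and c: "c > 0"
  shows "ln (ln (real (cover_num f (periodic_measures f) n e)))
     \<le> c * real n + ln (ln (2 * D / e * exp (c * real n) + 4))"
proof -
  define S where "S = sep_num f n (e / 2)"
  define B where "B = 2 * D / e * exp (c * real n) + 4"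
  define V where "V = cover_num f (periodic_measures f) n e"
  have S1: "1 \<le> S" unfolding S_def using sep_num_pos e by simp
  have S_le: "real S \<le> exp (c * real n)"
    using S S1 unfolding S_def[symmetric]
    by (metis exp_le_cancel_iff exp_ln of_nat_0_less_iff less_le_trans zero_less_one)
  \<comment> \<open>The summand 4 in \<open>B\<close> absorbs the rounding in \<open>K\<close> and
    makes \<open>ln B\<close> at least 1, so that \<open>ln (ln B)\<close> is nonnegative.\<close>
  have "exp 1 \<le> B"
    using exp_le D(2) e unfolding B_def by (smt (verit) divide_pos_pos exp_gt_zero mult_pos_pos)
  then have lnB: "1 \<le> ln B"
    by (metis exp_gt_zero ln_exp ln_mono order_less_le_trans)
  define K where "K = nat \<lceil>2 * D * real S / e\<rceil> + 2"
  have nonneg: "0 \<le> 2 * D * real S / e" using D(2) e by simp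
  then have K_ge: "2 * D * real S / e \<le> real K" unfolding K_def by linarith
  have "real K + 1 \<le> 2 * D * real S / e + 4"
    using nonneg unfolding K_def by linarith
  also have "\<dots> \<le> B"
    using mult_left_mono[OF S_le, of "2 * D / e"] D(2) e by (simp add: B_def)
  finally have K_le: "real K + 1 \<le> B" .
  have K0: "K > 0" by (simp add: K_def)
  have KD: "D * real (sep_num f n (e / 2)) / real K \<le> e / 2"
    using K_ge K0 e by (simp add: S_def field_simps)
  obtain C where C: "finite C" "C \<subseteq> prob_measures" "card C \<le> (K + 1) ^ S"
    "\<And>\<mu>. \<mu> \<in> periodic_measures f \<Longrightarrow> \<exists>\<nu>\<in>C. W1n f n \<mu> \<nu> \<le> e"
    using cover_periodic_measures[OF e D(1) K0 KD] unfolding S_def by metis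
  have V_le: "V \<le> (K + 1) ^ S"
    using cover_num_le[OF C(1,2), of "periodic_measures f" n e] C(3,4) unfolding V_def by simp
  show ?thesis
  \<comment> \<open>For \<open>V\<close> equal to 0 or 1 the iterated logarithm is 0, by
    \<open>ln 0 = 0\<close>.\<close>
  proof (cases "V \<le> 1")
    case True
    then have "V = 0 \<or> V = 1" by auto
    then have "ln (ln (real V)) = 0" by auto
    then show ?thesis using lnB c by (simp add: V_def B_def)
  next
    case False
    then have V: "0 < ln (real V)" by simp
    have "ln (real V) \<le> ln (real ((K + 1) ^ S))"
      using V_le False by (subst ln_le_cancel_iff) (auto simp del: of_nat_power of_nat_Suc)
    also have "\<dots> = real S * ln (real K + 1)"
      by (simp add: ln_realpow add.commute)
    also have "\<dots> \<le> real S * ln B"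
      using K_le K0 by (intro mult_left_mono) auto
    finally have "ln (ln (real V)) \<le> ln (real S * ln B)"
      using V by (subst ln_le_cancel_iff) linarith+
    also have "\<dots> = ln (real S) + ln (ln B)"
      using S1 lnB by (subst ln_mult) auto
    also have "\<dots> \<le> c * real n + ln (ln B)"
      using S by (simp add: S_def)
    finally show ?thesis by (simp add: V_def B_def)
  qed
qed

text \<open>Every real \<open>c\<close> above the separation rate is a bound, because the error
  \<open>ln (ln (A * exp (c * n) + 4))\<close> grows only like \<open>ln n\<close>.\<close>

lemma measure_entropy_upper_bound:
  assumes e: "e > 0"
  shows "limsup (\<lambda>n. ereal (ln (ln (real (cover_num f (periodic_measures f) n e))) / real n))
     \<le> limsup (\<lambda>n. ereal (ln (real (sep_num f n (e / 2))) / real n))" (is "?g \<le> ?s")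
proof (rule dense_ge)
  fix x assume x: "?s < x"
  have "0 \<le> ?s"
    using sep_num_pos[of "e / 2"] e by (intro le_Limsup always_eventually allI) auto
  show "?g \<le> x"
  proof (cases x)
    case (real c)
    with x \<open>0 \<le> ?s\<close> have c: "c > 0" by (metis ereal_less(2) order_le_less_trans)
    obtain D where D: "D > 0" "\<And>x y :: 'a. dist x y \<le> D" using diameter_bound by metis
    define A where "A = 2 * D / e"
    have "A > 0" using D e by (simp add: A_def)
    have "\<forall>\<^sub>F n in sequentially. ereal (ln (real (sep_num f n (e / 2))) / real n) < ereal c"
      using x real by (intro Limsup_lessD) simp
    then have "\<forall>\<^sub>F n in sequentially. ereal (ln (ln (real (cover_num f (periodic_measures f) n e))) / real n)
       \<le> ereal (c + ln (ln (A * exp (c * real n) + 4)) / real n)"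
      using eventually_gt_at_top[of 0]
    proof eventually_elim
      case (elim n)
      then have "ln (real (sep_num f n (e / 2))) \<le> c * real n" by (simp add: field_simps)
      from ln_ln_cover_num_le[OF e D(2) D(1) this c] elim(2) show ?case
        by (simp add: A_def field_simps)
    qed
    then have "?g \<le> limsup (\<lambda>n. ereal (c + ln (ln (A * exp (c * real n) + 4)) / real n))"
      by (rule Limsup_mono)
    also have "\<dots> = ereal c"
    proof (rule lim_imp_Limsup)
      have "(\<lambda>n. c + ln (ln (A * exp (c * real n) + 4)) / real n) \<longlonglongrightarrow> c"
        using \<open>A > 0\<close> c by real_asymp
      then show "(\<lambda>n. ereal (c + ln (ln (A * exp (c * real n) + 4)) / real n)) \<longlonglongrightarrow> ereal c"
        by simp
    qed simp
    finally show ?thesis using real by simp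
  qed (use x in auto)
qed

end

subsection \<open>Orbit measures and Lipschitz test functions\<close>

text \<open>Averages over times rather than points, so \<open>M\<close> may be any multiple of the
  least period.\<close>

definition orbit_pmf :: "('a \<Rightarrow> 'a) \<Rightarrow> 'a \<Rightarrow> nat \<Rightarrow> 'a pmf" where
  "orbit_pmf f p M = map_pmf (\<lambda>i. (f ^^ i) p) (pmf_of_set {..<M})"

text \<open>On times below \<open>M\<close> the map acts as the cyclic shift
  \<open>Suc i mod M\<close>, which preserves the uniform law.\<close>

lemma map_orbit_pmf:
  assumes "M > 0" "(f ^^ M) p = p"
  shows "map_pmf f (orbit_pmf f p M) = orbit_pmf f p M"
proof -
  let ?s = "\<lambda>i. Suc i mod M"
  have s: "?s i = (if Suc i = M then 0 else Suc i)" if "i < M" for i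
    using that by auto
  have inj: "inj_on ?s {..<M}"
    by (rule inj_onI) (auto simp: s split: if_splits)
  moreover have "?s ` {..<M} = {..<M}"
    by (rule endo_inj_surj[OF _ _ inj]) (use assms(1) in auto)
  ultimately have "map_pmf ?s (pmf_of_set {..<M}) = pmf_of_set {..<M}"
    using assms(1) by (intro map_pmf_of_set_bij_betw) (auto simp: bij_betw_def)
  then have "orbit_pmf f p M = map_pmf (\<lambda>i. (f ^^ i) p) (map_pmf ?s (pmf_of_set {..<M}))"
    unfolding orbit_pmf_def by (rule arg_cong[OF sym])
  also have "\<dots> = map_pmf (\<lambda>i. (f ^^ ?s i) p) (pmf_of_set {..<M})"
    unfolding pmf.map_comp comp_def ..
  also have "\<dots> = map_pmf (\<lambda>i. f ((f ^^ i) p)) (pmf_of_set {..<M})"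
  proof (intro map_pmf_cong refl)
    fix i assume "i \<in> set_pmf (pmf_of_set {..<M})"
    then have "i < M" using assms(1) by (subst (asm) set_pmf_of_set) auto
    then show "(f ^^ ?s i) p = f ((f ^^ i) p)"
      unfolding s[OF \<open>i < M\<close>] using assms(2) by auto
  qed
  also have "\<dots> = map_pmf f (orbit_pmf f p M)"
    by (simp add: orbit_pmf_def pmf.map_comp comp_def)
  finally show ?thesis by (rule sym)
qed

text \<open>Ergodicity holds because a fully invariant set contains the whole orbit or none of
  it.\<close>

lemma orbit_measure_periodic:
  fixes f :: "'a::t1_space \<Rightarrow> 'a"
  assumes "continuous_on UNIV f" "M > 0" "(f ^^ M) p = p"
  shows "pmf_borel (orbit_pmf f p M) \<in> periodic_measures f"
proof -
  have [measurable]: "f \<in> borel_measurable borel"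
    by (rule borel_measurable_continuous_onI[OF assms(1)])
  have meas: "measure (pmf_borel (orbit_pmf f p M)) A =
      measure (pmf_of_set {..<M}) {i. (f ^^ i) p \<in> A}" if "A \<in> sets borel" for A
    unfolding orbit_pmf_def pmf_borel_map using that
    by (subst measure_distr) (auto simp: vimage_def)
  have "push f (pmf_borel (orbit_pmf f p M)) = pmf_borel (map_pmf f (orbit_pmf f p M))"
    unfolding push_def pmf_borel_map unfolding pmf_borel_def
    by (subst distr_distr) (auto simp: comp_def)
  then have inv: "invariant_measure f (pmf_borel (orbit_pmf f p M))"
    by (simp add: invariant_measure_def pmf_borel_in_prob_measures map_orbit_pmf[OF assms(2,3)])
  have "measure (pmf_borel (orbit_pmf f p M)) A = 0 \<or> measure (pmf_borel (orbit_pmf f p M)) A = 1"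
    if A: "A \<in> sets borel" "f -` A = A" for A
  proof -
    have "(f ^^ i) p \<in> A \<longleftrightarrow> p \<in> A" for i
      by (induction i) (use A(2) in auto)
    then show ?thesis
      unfolding meas[OF A(1)] by (cases "p \<in> A") (simp_all add: measure_pmf.prob_space[unfolded space_measure_pmf])
  qed
  moreover have "measure (pmf_borel (orbit_pmf f p M)) (range (\<lambda>i. (f ^^ i) p)) = 1"
    using finite_periodic_orbit[OF assms(2,3)]
    by (subst meas) (auto intro!: borel_closed finite_imp_closed simp: measure_pmf.prob_space[unfolded space_measure_pmf])
  ultimately show ?thesis
    using inv assms(2,3) unfolding periodic_measures_def ergodic_measure_def by blast
qed

text \<open>An image of the product measure; as the first factor is indexed by \<open>nat\<close>,
  measurability into the Borel sets of the product space is checked one index at a time. An infimum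
  over an empty set of plans would give no information.\<close>

lemma couplings_nonempty:
  fixes g :: "nat \<Rightarrow> 'a::metric_space"
  assumes "\<nu> \<in> prob_measures"
  shows "couplings (pmf_borel (map_pmf g Q)) \<nu> \<noteq> {}"
proof -
  interpret \<nu>: prob_space \<nu> using assms by (simp add: prob_measures_def)
  have sets: "sets \<nu> = sets borel" using assms by (simp add: prob_measures_def)
  interpret P: pair_prob_space "measure_pmf Q" \<nu> ..
  let ?h = "\<lambda>(i, y). (g i, y)" and ?P = "measure_pmf Q \<Otimes>\<^sub>M \<nu>"
  have "?h \<in> measurable (count_space UNIV \<Otimes>\<^sub>M borel) borel"
    by (rule measurable_pair_measure_countable1)
      (auto intro!: borel_measurable_continuous_onI continuous_intros)
  also have "\<dots> = measurable ?P borel"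
    by (intro measurable_cong_sets sets_pair_measure_cong) (simp_all add: sets)
  finally have h: "?h \<in> measurable ?P borel" .
  have ms: "fst \<in> borel_measurable (borel :: ('a \<times> 'a) measure)"
    "snd \<in> borel_measurable (borel :: ('a \<times> 'a) measure)"
    by (auto intro!: borel_measurable_continuous_onI continuous_intros)
  have "distr (distr ?P borel ?h) borel fst = distr ?P borel (\<lambda>z. g (fst z))"
    by (subst distr_distr[OF ms(1) h]) (simp add: comp_def split_beta)
  also have "\<dots> = distr (distr ?P (measure_pmf Q) fst) borel g"
    by (subst distr_distr) (auto simp: comp_def)
  also have "\<dots> = pmf_borel (map_pmf g Q)"
    unfolding pmf_borel_map by (subst \<nu>.distr_pair_fst) simp
  finally have 1: "distr (distr ?P borel ?h) borel fst = pmf_borel (map_pmf g Q)" .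
  have "distr (distr ?P borel ?h) borel snd = distr ?P borel snd"
    by (subst distr_distr[OF ms(2) h]) (simp add: comp_def split_beta)
  also have "\<dots> = distr ?P \<nu> snd" by (rule distr_cong) (simp_all add: sets)
  also have "\<dots> = \<nu>"
  proof (rule measure_eqI)
    fix A assume "A \<in> sets (distr ?P \<nu> snd)"
    then have A: "A \<in> sets \<nu>" by simp
    then have "emeasure (distr ?P \<nu> snd) A = emeasure ?P (UNIV \<times> A)"
      by (subst emeasure_distr)
        (auto simp: space_pair_measure dest: sets.sets_into_space intro!: arg_cong2[where f=emeasure])
    also have "\<dots> = emeasure \<nu> A"
      using A by (subst \<nu>.emeasure_pair_measure_Times) (auto simp: measure_pmf.emeasure_space_1[unfolded space_measure_pmf])
    finally show "emeasure (distr ?P \<nu> snd) A = emeasure \<nu> A" .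
  qed simp
  finally have 2: "distr (distr ?P borel ?h) borel snd = \<nu>" .
  have "distr ?P borel ?h \<in> couplings (pmf_borel (map_pmf g Q)) \<nu>"
    unfolding couplings_def using 1 2 P.prob_space_distr[OF h] by simp
  then show ?thesis by blast
qed

context compact_system begin

lemma dn_lipschitz_continuous:
  fixes \<phi> :: "'a \<Rightarrow> real"
  assumes "\<And>x y. \<bar>\<phi> x - \<phi> y\<bar> \<le> dn f n x y"
  shows "continuous_on UNIV \<phi>"
proof (unfold continuous_on_iff, intro ballI allI impI)
  fix x :: 'a and e :: real assume "e > 0"
  then obtain d where "d > 0" "\<And>x y. dist x y < d \<Longrightarrow> dn f n x y < e"
    using dn_uniform[of e n] by metis
  then show "\<exists>d>0. \<forall>x'\<in>UNIV. dist x' x < d \<longrightarrow> dist (\<phi> x') (\<phi> x) < e"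
    using assms by (metis dist_real_def order_le_less_trans)
qed

text \<open>The elementary half of Kantorovich duality: integrate
  \<open>\<phi> (fst z) - \<phi> (snd z)\<close> against a plan within \<eta> of the
  infimum.\<close>

lemma W1n_lipschitz:
  fixes \<phi> :: "'a \<Rightarrow> real"
  assumes lip: "\<And>x y. \<bar>\<phi> x - \<phi> y\<bar> \<le> dn f n x y"
    and W: "W1n f n \<mu> \<nu> \<le> e" and ne: "couplings \<mu> \<nu> \<noteq> {}"
  shows "\<bar>integral\<^sup>L \<mu> \<phi> - integral\<^sup>L \<nu> \<phi>\<bar> \<le> e"
proof (rule field_le_epsilon)
  fix \<eta> :: real assume "\<eta> > 0"
  then have "Inf ((\<lambda>\<pi>. integral\<^sup>L \<pi> (\<lambda>(x, y). dn f n x y)) ` couplings \<mu> \<nu>) < e + \<eta>"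
    using W by (simp add: W1n_def)
  then obtain \<pi> where \<pi>: "\<pi> \<in> couplings \<mu> \<nu>" "integral\<^sup>L \<pi> (\<lambda>(x, y). dn f n x y) < e + \<eta>"
    using ne by (subst (asm) cInf_less_iff[OF _ bdd_below_coupling_costs]) auto
  interpret prob_space \<pi> using \<pi>(1) by (simp add: couplings_def)
  have sets[measurable_cong]: "sets \<pi> = sets borel" using \<pi>(1) by (simp add: couplings_def)
  have [measurable]: "\<phi> \<in> borel_measurable borel"
    by (rule borel_measurable_continuous_onI[OF dn_lipschitz_continuous[OF lip]])
  have ms: "fst \<in> borel_measurable (borel :: ('a \<times> 'a) measure)"
    "snd \<in> borel_measurable (borel :: ('a \<times> 'a) measure)"
    by (auto intro!: borel_measurable_continuous_onI continuous_intros)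
  then have [measurable]: "fst \<in> measurable \<pi> (borel :: 'a measure)" "snd \<in> measurable \<pi> (borel :: 'a measure)"
    using measurable_cong_sets[OF sets refl] by blast+
  obtain D where D: "D > 0" "\<And>x y :: 'a. dist x y \<le> D" using diameter_bound by metis
  have dnD: "dn f n x y \<le> D" for x y using D by (simp add: dn_le_iff)
  define B where "B = \<bar>\<phi> undefined\<bar> + D"
  have B: "\<bar>\<phi> x\<bar> \<le> B" for x
    using lip[of x undefined] dnD[of x undefined] by (simp add: B_def)
  have "integral\<^sup>L \<mu> \<phi> = (\<integral>z. \<phi> (fst z) \<partial>\<pi>)" "integral\<^sup>L \<nu> \<phi> = (\<integral>z. \<phi> (snd z) \<partial>\<pi>)"
    using \<pi>(1) unfolding couplings_def by (auto simp: integral_distr)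
  moreover have i: "integrable \<pi> (\<lambda>z. \<phi> (fst z))" "integrable \<pi> (\<lambda>z. \<phi> (snd z))"
    using B by (auto intro!: integrable_const_bound[where B = B])
  ultimately have "\<bar>integral\<^sup>L \<mu> \<phi> - integral\<^sup>L \<nu> \<phi>\<bar> = \<bar>\<integral>z. \<phi> (fst z) - \<phi> (snd z) \<partial>\<pi>\<bar>"
    by simp
  also have "\<dots> \<le> (\<integral>z. \<bar>\<phi> (fst z) - \<phi> (snd z)\<bar> \<partial>\<pi>)"
    using integral_norm_bound[of \<pi> "\<lambda>z. \<phi> (fst z) - \<phi> (snd z)"] by simp
  also have "\<dots> \<le> (\<integral>z. dn f n (fst z) (snd z) \<partial>\<pi>)"
  proof (rule integral_mono)
    have "(\<lambda>z. dn f n (fst z) (snd z)) \<in> borel_measurable \<pi>"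
      using borel_measurable_continuous_onI[OF continuous_dn[of n]] measurable_cong_sets[OF sets refl] by blast
    then show "integrable \<pi> (\<lambda>z. dn f n (fst z) (snd z))"
      using dnD dn_nonneg[of f n] by (intro integrable_const_bound[where B = D]) auto
  qed (use i lip in auto)
  finally show "\<bar>integral\<^sup>L \<mu> \<phi> - integral\<^sup>L \<nu> \<phi>\<bar> \<le> e + \<eta>"
    using \<pi>(2) unfolding case_prod_beta' by linarith
qed

lemma integral_orbit_measure:
  fixes \<phi> :: "'a \<Rightarrow> real"
  assumes "\<And>x y. \<bar>\<phi> x - \<phi> y\<bar> \<le> dn f n x y" "M > 0"
  shows "integral\<^sup>L (pmf_borel (orbit_pmf f p M)) \<phi> = (\<Sum>s<M. \<phi> ((f ^^ s) p)) / real M"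
proof -
  have "\<phi> \<in> borel_measurable borel"
    by (rule borel_measurable_continuous_onI[OF dn_lipschitz_continuous[OF assms(1)]])
  then show ?thesis
    unfolding orbit_pmf_def pmf_borel_map using assms(2)
    by (subst integral_distr) (auto simp: integral_pmf_of_set lessThan_empty_iff)
qed

end

subsection \<open>Counting words\<close>

text \<open>The sums for the \<open>W\<close> offsets together run once through the times from
  \<open>t\<close> up to \<open>t + L * W\<close>, so one of them is at most the average.\<close>

lemma sum_block_average:
  fixes g :: "nat \<Rightarrow> real"
  assumes nonneg: "\<And>s. 0 \<le> g s" and "W > 0" "t + L * W \<le> M"
  shows "\<exists>i<W. (\<Sum>j<L. g (t + (j * W + i))) \<le> (\<Sum>s<M. g s) / real W"
proof (rule ccontr)
  assume "\<not> ?thesis"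
  then have "(\<Sum>s<M. g s) / real W < (\<Sum>j<L. g (t + (j * W + i)))" if "i < W" for i
    using that by (simp add: not_le)
  then have "(\<Sum>i<W. (\<Sum>s<M. g s) / real W) < (\<Sum>i<W. \<Sum>j<L. g (t + (j * W + i)))"
    using assms(2) by (intro sum_strict_mono) auto
  also have "\<dots> = (\<Sum>j<L. \<Sum>i<W. g (t + (j * W + i)))"
    by (rule sum.swap)
  also have "\<dots> = (\<Sum>j<L. sum (\<lambda>s. g (t + s)) {j * W..<j * W + W})"
  proof (rule sum.cong[OF refl])
    fix j
    show "(\<Sum>i<W. g (t + (j * W + i))) = sum (\<lambda>s. g (t + s)) {j * W..<j * W + W}"
      using sum.shift_bounds_nat_ivl[of "\<lambda>s. g (t + s)" 0 "j * W" W]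
      by (simp add: atLeast0LessThan add_ac)
  qed
  also have "\<dots> = (\<Sum>s<L * W. g (t + s))"
    by (rule sum.nat_group)
  also have "\<dots> = sum g ((+) t ` {..<L * W})"
    by (subst sum.reindex) auto
  also have "\<dots> \<le> (\<Sum>s<M. g s)"
    using assms(3) nonneg by (intro sum_mono2) auto
  finally show False using assms(2) by simp
qed

context compact_system begin

text \<open>A word is recovered from the orbit points closest to its windows at offset \<open>i\<close> together with the
  letters meeting a bad window; letter \<open>j\<close> is covered by the windows \<open>j - 1\<close> and \<open>j\<close>.\<close>

lemma card_coded_words:
  fixes p :: "(nat \<Rightarrow> 'a) \<Rightarrow> 'a" and W :: nat
  assumes E: "finite E" "separated f n e E" "E \<noteq> {}" and e: "e > 0" and nW: "n \<le> W" and i: "i < W"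
    and A: "finite A" and B: "B \<subseteq> {..<L}"
    and shadow: "\<And>x j k. x \<in> {..<L} \<rightarrow>\<^sub>E E \<Longrightarrow> j < L \<Longrightarrow> k < n \<Longrightarrow>
      dist ((f ^^ (t + (j * W + k))) (p x)) ((f ^^ k) (x j)) \<le> e / 4"
  shows "card {x \<in> {..<L} \<rightarrow>\<^sub>E E. \<forall>j<L. j \<notin> B \<longrightarrow> (\<exists>a\<in>A. dn f W ((f ^^ (t + (j * W + i))) (p x)) a \<le> e / 4)}
     \<le> Suc (card A) ^ L * card E ^ (2 * card B + 1)" (is "card ?X \<le> _")
proof -
  \<comment> \<open>A letter is stored verbatim if one of its two windows is bad; letter 0 always
    is, as no window precedes it.\<close>
  define B' where "B' = {..<L} \<inter> insert 0 (B \<union> Suc ` B)"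
  have finB: "finite B" using B finite_subset by blast
  have "card B' \<le> card (insert 0 (B \<union> Suc ` B))"
    unfolding B'_def using finB by (intro card_mono) auto
  also have "\<dots> \<le> Suc (card (B \<union> Suc ` B))" by (rule card_insert_le_m1) (use card_insert_if finB in auto)
  also have "\<dots> \<le> Suc (card B + card (Suc ` B))" using card_Un_le by blast
  also have "\<dots> \<le> 2 * card B + 1" using card_image_le[OF finB, of Suc] by simp
  finally have B'_card: "card B' \<le> 2 * card B + 1" .
  have finB': "finite B'" by (simp add: B'_def)
  define c where "c x j = (SOME a. a \<in> A \<and> dn f W ((f ^^ (t + (j * W + i))) (p x)) a \<le> e / 4)" for x j
  have c: "c x j \<in> A" "dn f W ((f ^^ (t + (j * W + i))) (p x)) (c x j) \<le> e / 4"
    if "x \<in> ?X" "j < L" "j \<notin> B" for x j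
  proof -
    have "\<exists>a. a \<in> A \<and> dn f W ((f ^^ (t + (j * W + i))) (p x)) a \<le> e / 4"
      using that by blast
    from someI_ex[OF this] show "c x j \<in> A" "dn f W ((f ^^ (t + (j * W + i))) (p x)) (c x j) \<le> e / 4"
      unfolding c_def by blast+
  qed
  \<comment> \<open>\<open>None\<close> marks a bad window, so each position has at most
    \<open>Suc (card A)\<close> values.\<close>
  define enc where "enc x = (\<lambda>j\<in>{..<L}. if j \<in> B then None else Some (c x j))" for x
  define code where "code x = (enc x, restrict x B')" for x
  have window: "dist ((f ^^ (t + (j * W + i + k))) (p x)) ((f ^^ (t + (j * W + i + k))) (p y)) \<le> e / 2"
    if xy: "x \<in> ?X" "y \<in> ?X" "enc x = enc y" and j: "j < L" "j \<notin> B" and k: "k < W" for x y j k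
  proof -
    have "c x j = c y j" using fun_cong[OF xy(3), of j] j by (simp add: enc_def)
    then have "dn f W ((f ^^ (t + (j * W + i))) (p x)) ((f ^^ (t + (j * W + i))) (p y)) \<le> e / 4 + e / 4"
      using c(2)[OF xy(1) j] c(2)[OF xy(2) j]
        dn_triangle[of f W "(f ^^ (t + (j * W + i))) (p x)" "(f ^^ (t + (j * W + i))) (p y)" "c x j"]
        dn_commute[of f W "c x j" "(f ^^ (t + (j * W + i))) (p y)"] by simp
    then have "dist ((f ^^ k) ((f ^^ (t + (j * W + i))) (p x))) ((f ^^ k) ((f ^^ (t + (j * W + i))) (p y))) \<le> e / 2"
      using dist_funpow_le_dn[OF k, of f "(f ^^ (t + (j * W + i))) (p x)" "(f ^^ (t + (j * W + i))) (p y)"]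
      by simp
    moreover have "(f ^^ k) ((f ^^ (t + (j * W + i))) z) = (f ^^ (t + (j * W + i + k))) z" for z
      using funpow_add[of k "t + (j * W + i)" f] by (simp add: add_ac)
    ultimately show ?thesis by simp
  qed
  have "inj_on code ?X"
  proof (rule inj_onI, rule ccontr)
    fix x y assume x: "x \<in> ?X" and y: "y \<in> ?X" and eq: "code x = code y" and "x \<noteq> y"
    have xE: "x \<in> {..<L} \<rightarrow>\<^sub>E E" and yE: "y \<in> {..<L} \<rightarrow>\<^sub>E E" using x y by auto
    have enc: "enc x = enc y" and res: "restrict x B' = restrict y B'"
      using eq by (simp_all add: code_def)
    obtain j where j: "j < L" "x j \<noteq> y j"
      using PiE_ext[OF xE yE] \<open>x \<noteq> y\<close> by blast
    have "j \<notin> B'" using fun_cong[OF res, of j] j(2) by (auto simp: restrict_def split: if_splits)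
    then have j': "0 < j" "j \<notin> B" "j - 1 \<notin> B"
      using j(1) by (auto simp: B'_def image_iff)
    have "x j \<in> E" "y j \<in> E" using xE yE j(1) by auto
    then have "e < dn f n (x j) (y j)" using E(2) j(2) by (simp add: separated_def)
    then obtain k where k: "k < n" "e < dist ((f ^^ k) (x j)) ((f ^^ k) (y j))"
      using e by (auto simp: dn_gt_iff)
    have "dist ((f ^^ (t + (j * W + k))) (p x)) ((f ^^ (t + (j * W + k))) (p y)) \<le> e / 2"
    \<comment> \<open>Time \<open>k\<close> of letter \<open>j\<close> lies in window
      \<open>j\<close> if \<open>i \<le> k\<close>, otherwise at position \<open>k + W - i\<close>
      of window \<open>j - 1\<close>.\<close>
    proof (cases "i \<le> k")
      case True
      then show ?thesis
        using window[OF x y enc j(1) j'(2), of "k - i"] k(1) nW by simp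
    next
      case False
      have "(j - 1) * W + i + (k + W - i) = j * W + k"
        using False i j'(1) by (cases j) auto
      moreover have "j - 1 < L" "k + W - i < W" using False i j(1) by auto
      ultimately show ?thesis
        using window[OF x y enc _ j'(3), of "k + W - i"] by simp
    qed
    then have "dist ((f ^^ k) (x j)) ((f ^^ k) (y j)) \<le> e"
      using shadow[OF xE j(1) k(1)] shadow[OF yE j(1) k(1)]
        dist_triangle3[of "(f ^^ k) (x j)" "(f ^^ k) (y j)" "(f ^^ (t + (j * W + k))) (p x)"]
        dist_triangle[of "(f ^^ (t + (j * W + k))) (p x)" "(f ^^ k) (y j)" "(f ^^ (t + (j * W + k))) (p y)"]
      by linarith
    with k(2) show False by simp
  qed
  moreover have "code ` ?X \<subseteq> ({..<L} \<rightarrow>\<^sub>E insert None (Some ` A)) \<times> (B' \<rightarrow>\<^sub>E E)"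
  proof (rule image_subsetI)
    fix x assume x: "x \<in> ?X"
    have "enc x \<in> {..<L} \<rightarrow>\<^sub>E insert None (Some ` A)"
      using c(1)[OF x] by (auto simp: enc_def)
    moreover have "restrict x B' \<in> B' \<rightarrow>\<^sub>E E"
      using x by (auto simp: B'_def)
    ultimately show "code x \<in> ({..<L} \<rightarrow>\<^sub>E insert None (Some ` A)) \<times> (B' \<rightarrow>\<^sub>E E)"
      by (simp add: code_def)
  qed
  moreover have "finite (({..<L} \<rightarrow>\<^sub>E insert None (Some ` A)) \<times> (B' \<rightarrow>\<^sub>E E))"
    using A E(1) finB' by (auto intro!: finite_PiE)
  ultimately have "card ?X \<le> card (({..<L} \<rightarrow>\<^sub>E insert None (Some ` A)) \<times> (B' \<rightarrow>\<^sub>E E))"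
    by (rule card_inj_on_le)
  also have "\<dots> = Suc (card A) ^ L * card E ^ card B'"
    using A finB' by (simp add: card_cartesian_product card_PiE card_image image_iff)
  also have "\<dots> \<le> Suc (card A) ^ L * card E ^ (2 * card B + 1)"
  proof (intro mult_left_mono power_increasing B'_card)
    show "1 \<le> card E" using E(1,3) by (simp add: Suc_leI card_gt_0_iff)
  qed simp
  finally show ?thesis .
qed

text \<open>Fix a word \<open>w\<close> of the ball and test with the distance to its orbit, which
  vanishes there. Its mean along the orbit of any word of the ball is small, so for some offset few
  windows are farther than \<open>e / 4\<close> from that orbit, and such words are counted by their
  codes. The 16 is 2 for passing through \<nu>, 2 for \<open>M \<le> 2 * (L * W)\<close> and 4 for
  the threshold.\<close>

lemma card_words_near_measure:
  fixes p :: "(nat \<Rightarrow> 'a) \<Rightarrow> 'a" and W :: nat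
  assumes E: "finite E" "separated f n e E" "E \<noteq> {}" and e: "e > 0" and nW: "n \<le> W" and W: "W > 0"
    and shadow: "\<And>x j k. x \<in> {..<L} \<rightarrow>\<^sub>E E \<Longrightarrow> j < L \<Longrightarrow> k < n \<Longrightarrow>
      dist ((f ^^ (t + (j * W + k))) (p x)) ((f ^^ k) (x j)) \<le> e / 4"
    and M: "t + L * W \<le> M" "M \<le> 2 * (L * W)" "M > 0" and \<beta>: "0 \<le> \<beta>" and \<nu>: "\<nu> \<in> prob_measures"
  shows "card {x \<in> {..<L} \<rightarrow>\<^sub>E E. W1n f W (pmf_borel (orbit_pmf f (p x) M)) \<nu> \<le> \<beta> * e / 16}
     \<le> W * (2 ^ L * (Suc M ^ L * card E ^ (2 * nat \<lfloor>\<beta> * real L\<rfloor> + 1)))" (is "card ?X \<le> _")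
proof (cases "?X = {}")
  case False
  then obtain w where w: "w \<in> ?X" by blast
  define \<epsilon> where "\<epsilon> = \<beta> * e / 16"
  define b where "b = nat \<lfloor>\<beta> * real L\<rfloor>"
  define A where "A = (\<lambda>s. (f ^^ s) (p w)) ` {..<M}"
  have A: "finite A" "A \<noteq> {}" using M(3) by (auto simp: A_def)
  have A_card: "card A \<le> M" unfolding A_def using card_image_le[of "{..<M}"] by simp
  define \<phi> where "\<phi> x = Min (dn f W x ` A)" for x
  have \<phi>_le: "\<phi> x \<le> dn f W x a" if "a \<in> A" for x a
    unfolding \<phi>_def using A that by (intro Min_le) auto
  have \<phi>_ex: "\<exists>a\<in>A. \<phi> x = dn f W x a" for x
    using Min_in[of "dn f W x ` A"] A unfolding \<phi>_def by blast
  have \<phi>_nonneg: "0 \<le> \<phi> x" for x using \<phi>_ex[of x] dn_nonneg by metis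
  have \<phi>_tri: "\<phi> x \<le> \<phi> y + dn f W x y" for x y
  proof -
    obtain a where "a \<in> A" "\<phi> y = dn f W y a" using \<phi>_ex by blast
    then show ?thesis using \<phi>_le[of a x] dn_triangle[of f W x a y] by simp
  qed
  have lip: "\<bar>\<phi> x - \<phi> y\<bar> \<le> dn f W x y" for x y
    using \<phi>_tri[of x y] \<phi>_tri[of y x] dn_commute[of f W x y] by simp
  have near: "\<bar>integral\<^sup>L (pmf_borel (orbit_pmf f (p x) M)) \<phi> - integral\<^sup>L \<nu> \<phi>\<bar> \<le> \<epsilon>" if "x \<in> ?X" for x
  proof (rule W1n_lipschitz[OF lip])
    show "W1n f W (pmf_borel (orbit_pmf f (p x) M)) \<nu> \<le> \<epsilon>" using that by (simp add: \<epsilon>_def)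
    show "couplings (pmf_borel (orbit_pmf f (p x) M)) \<nu> \<noteq> {}"
      unfolding orbit_pmf_def by (rule couplings_nonempty[OF \<nu>])
  qed
  have "\<phi> ((f ^^ s) (p w)) = 0" if "s < M" for s
  proof (rule antisym)
    show "\<phi> ((f ^^ s) (p w)) \<le> 0"
      using \<phi>_le[of "(f ^^ s) (p w)" "(f ^^ s) (p w)"] that by (simp add: A_def)
  qed (rule \<phi>_nonneg)
  then have w0: "integral\<^sup>L (pmf_borel (orbit_pmf f (p w) M)) \<phi> = 0"
    unfolding integral_orbit_measure[OF lip M(3)] by simp
  define X where "X i B = {x \<in> {..<L} \<rightarrow>\<^sub>E E. \<forall>j<L. j \<notin> B \<longrightarrow>
      (\<exists>a\<in>A. dn f W ((f ^^ (t + (j * W + i))) (p x)) a \<le> e / 4)}" for i B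
  define \<B> where "\<B> = {B \<in> Pow {..<L}. card B \<le> b}"
  have fin_X: "finite (X i B)" for i B
    unfolding X_def using E(1) by (intro finite_subset[OF _ finite_PiE[of "{..<L}" "\<lambda>_. E"]]) auto
  have "?X \<subseteq> (\<Union>i\<in>{..<W}. \<Union>B\<in>\<B>. X i B)"
  proof
    fix x assume x: "x \<in> ?X"
    have "(\<Sum>s<M. \<phi> ((f ^^ s) (p x))) / real M \<le> 2 * \<epsilon>"
      using near[OF x] near[OF w] w0 integral_orbit_measure[OF lip M(3), of "p x"] by linarith
    then have sum_le: "(\<Sum>s<M. \<phi> ((f ^^ s) (p x))) \<le> 2 * \<epsilon> * real M"
      using M(3) by (simp add: pos_divide_le_eq)
    obtain i where i: "i < W" "(\<Sum>j<L. \<phi> ((f ^^ (t + (j * W + i))) (p x))) \<le> (\<Sum>s<M. \<phi> ((f ^^ s) (p x))) / real W"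
      using sum_block_average[of "\<lambda>s. \<phi> ((f ^^ s) (p x))", OF \<phi>_nonneg W M(1)] by blast
    define B where "B = {j \<in> {..<L}. e / 4 < \<phi> ((f ^^ (t + (j * W + i))) (p x))}"
    have "real M \<le> real (2 * (L * W))" using M(2) of_nat_le_iff by blast
    then have M': "real M \<le> 2 * (real L * real W)" by simp
    \<comment> \<open>Markov's inequality for the number of bad windows.\<close>
    have "real (card B) * (e / 4) = (\<Sum>j\<in>B. e / 4)" by simp
    also have "\<dots> \<le> (\<Sum>j\<in>B. \<phi> ((f ^^ (t + (j * W + i))) (p x)))"
      by (intro sum_mono) (simp add: B_def)
    also have "\<dots> \<le> (\<Sum>j<L. \<phi> ((f ^^ (t + (j * W + i))) (p x)))"
      by (intro sum_mono2) (auto simp: B_def \<phi>_nonneg)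
    also have "\<dots> \<le> 2 * \<epsilon> * real M / real W"
      using i(2) divide_right_mono[OF sum_le, of "real W"] by simp
    also have "\<dots> \<le> 2 * \<epsilon> * (2 * (real L * real W)) / real W"
      using M' \<beta> e by (intro divide_right_mono mult_left_mono) (auto simp: \<epsilon>_def)
    also have "\<dots> = \<beta> * real L * (e / 4)" using W by (simp add: \<epsilon>_def)
    finally have "real (card B) \<le> \<beta> * real L" using e by simp
    then have "card B \<le> b" unfolding b_def by (simp add: le_nat_iff le_floor_iff)
    then have "B \<in> \<B>" by (auto simp: \<B>_def B_def)
    moreover have "x \<in> X i B"
    proof -
      have "\<exists>a\<in>A. dn f W ((f ^^ (t + (j * W + i))) (p x)) a \<le> e / 4" if "j < L" "j \<notin> B" for j
      proof -
        have "\<phi> ((f ^^ (t + (j * W + i))) (p x)) \<le> e / 4" using that by (simp add: B_def)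
        then show ?thesis using \<phi>_ex[of "(f ^^ (t + (j * W + i))) (p x)"] by force
      qed
      then show ?thesis using x by (simp add: X_def)
    qed
    ultimately show "x \<in> (\<Union>i\<in>{..<W}. \<Union>B\<in>\<B>. X i B)" using i(1) by blast
  qed
  moreover have fin_B: "finite \<B>" by (simp add: \<B>_def)
  ultimately have "card ?X \<le> card (\<Union>i\<in>{..<W}. \<Union>B\<in>\<B>. X i B)"
    using fin_X by (intro card_mono) auto
  also have "\<dots> \<le> (\<Sum>i<W. card (\<Union>B\<in>\<B>. X i B))"
    by (rule card_UN_le) simp
  also have "\<dots> \<le> (\<Sum>i<W. \<Sum>B\<in>\<B>. card (X i B))"
    by (intro sum_mono card_UN_le fin_B)
  also have "\<dots> \<le> (\<Sum>i<W. \<Sum>B\<in>\<B>. Suc M ^ L * card E ^ (2 * b + 1))"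
  proof (intro sum_mono)
    fix i B assume i: "i \<in> {..<W}" and B: "B \<in> \<B>"
    have "card (X i B) \<le> Suc (card A) ^ L * card E ^ (2 * card B + 1)"
      unfolding X_def by (rule card_coded_words[OF E e nW _ A(1) _ shadow]) (use i B in \<open>auto simp: \<B>_def\<close>)
    also have "\<dots> \<le> Suc M ^ L * card E ^ (2 * b + 1)"
    proof (intro mult_mono power_mono power_increasing)
      show "1 \<le> card E" using E(1,3) by (simp add: Suc_leI card_gt_0_iff)
      show "2 * card B + 1 \<le> 2 * b + 1" using B by (simp add: \<B>_def)
    qed (use A_card in simp_all)
    finally show "card (X i B) \<le> Suc M ^ L * card E ^ (2 * b + 1)" .
  qed
  also have "\<dots> = W * (card \<B> * (Suc M ^ L * card E ^ (2 * b + 1)))" by simp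
  also have "\<dots> \<le> W * (2 ^ L * (Suc M ^ L * card E ^ (2 * b + 1)))"
  proof (intro mult_left_mono mult_right_mono)
    have "card \<B> \<le> card (Pow {..<L})" by (intro card_mono) (auto simp: \<B>_def)
    then show "card \<B> \<le> 2 ^ L" by (simp add: card_Pow)
  qed simp_all
  finally show ?thesis unfolding b_def .
next
  case True
  then show ?thesis by (metis card.empty le0)
qed

text \<open>An infimum in \<open>nat\<close> is attained once the set is nonempty, and rounding with
  \<open>K\<close> large enough provides a finite cover.\<close>

lemma cover_num_attained:
  assumes "e > 0"
  obtains C where "finite C" "C \<subseteq> prob_measures" "card C = cover_num f (periodic_measures f) n e"
    "\<And>\<mu>. \<mu> \<in> periodic_measures f \<Longrightarrow> \<exists>\<nu>\<in>C. W1n f n \<mu> \<nu> \<le> e"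
proof -
  let ?S = "{card E | E. finite E \<and> E \<subseteq> prob_measures \<and>
      (\<forall>\<mu>\<in>periodic_measures f. \<exists>\<nu>\<in>E. W1n f n \<mu> \<nu> \<le> e)}"
  obtain D where D: "D > 0" "\<And>x y :: 'a. dist x y \<le> D" using diameter_bound by metis
  define K where "K = nat \<lceil>2 * D * real (sep_num f n (e / 2)) / e\<rceil> + 1"
  have "K > 0" by (simp add: K_def)
  have "2 * D * real (sep_num f n (e / 2)) / e \<le> real K"
    unfolding K_def by linarith
  then have "D * real (sep_num f n (e / 2)) / real K \<le> e / 2"
    using \<open>K > 0\<close> assms by (simp add: field_simps)
  from cover_periodic_measures[OF assms D(2) \<open>K > 0\<close> this]
  obtain C where "finite C" "C \<subseteq> prob_measures"
    "\<And>\<mu>. \<mu> \<in> periodic_measures f \<Longrightarrow> \<exists>\<nu>\<in>C. W1n f n \<mu> \<nu> \<le> e"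
    by metis
  then have "card C \<in> ?S" by blast
  then have "Inf ?S \<in> ?S" by (intro Inf_nat_def1) blast
  then show ?thesis unfolding cover_num_def[symmetric] using that by auto
qed

end

section \<open>Lower bound and comparison of the growth rates\<close>

context specified_system begin

text \<open>Every word over \<open>E\<close> gives a periodic measure, a minimal cover distributes
  the words among its balls, and each ball holds few of them. \<open>N\<close> and \<open>G\<close>
  depend on \<open>e\<close> alone.\<close>

lemma card_words_le_cover_num:
  assumes e: "e > 0"
  obtains N G where "G > 0" "\<And>n L E \<beta>. finite E \<Longrightarrow> E \<noteq> {} \<Longrightarrow> separated f n e E \<Longrightarrow> 0 < \<beta> \<Longrightarrow>
      0 < n \<Longrightarrow> G \<le> L \<Longrightarrow>
      card E ^ L \<le> cover_num f (periodic_measures f) (n + N) (\<beta> * e / 16) *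
        ((n + N) * (2 ^ L * (Suc (L * (n + N) + G) ^ L * card E ^ (2 * nat \<lfloor>\<beta> * real L\<rfloor> + 1))))"
proof -
  \<comment> \<open>The word is shadowed by \<open>q\<close> and \<open>q\<close> by a periodic
    point, each within \<open>e / 8\<close>; together this is the \<open>e / 4\<close> of the
    coding.\<close>
  have e8: "e / 8 > 0" using e by simp
  obtain N where N: "\<And>x L n. \<exists>p. \<forall>j<L. \<forall>i<n. dist ((f ^^ (j * (n + N) + i)) p) ((f ^^ i) (x j)) < e / 8"
    using word_shadowing[OF e8] by metis
  obtain G t where G: "t \<le> G" "G > 0"
    "\<And>x n. \<exists>p. (f ^^ (n + G)) p = p \<and> (\<forall>i<n. dist ((f ^^ (t + i)) p) ((f ^^ i) x) \<le> e / 8)"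
    using periodic_shadowing[OF e8] by metis
  show ?thesis
  proof (rule that[OF G(2)])
    fix n L :: nat and E :: "'a set" and \<beta> :: real
    assume E: "finite E" "E \<noteq> {}" "separated f n e E" and \<beta>: "0 < \<beta>" and n: "0 < n" and L: "G \<le> L"
    define W where "W = n + N"
    define M where "M = L * W + G"
    have W: "W > 0" "n \<le> W" using n by (auto simp: W_def)
    have "\<exists>p. (f ^^ M) p = p \<and> (\<forall>j<L. \<forall>k<n. dist ((f ^^ (t + (j * W + k))) p) ((f ^^ k) (x j)) \<le> e / 4)" for x
    proof -
      obtain q where q: "\<And>j i. j < L \<Longrightarrow> i < n \<Longrightarrow> dist ((f ^^ (j * W + i)) q) ((f ^^ i) (x j)) < e / 8"
        using N unfolding W_def by metis
      obtain p where p: "(f ^^ M) p = p" "\<And>i. i < L * W \<Longrightarrow> dist ((f ^^ (t + i)) p) ((f ^^ i) q) \<le> e / 8"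
        using G(3)[of "L * W" q] unfolding M_def by blast
      have "dist ((f ^^ (t + (j * W + k))) p) ((f ^^ k) (x j)) \<le> e / 4" if "j < L" "k < n" for j k
      proof -
        have "j * W + k < Suc j * W" using that W by simp
        also have "\<dots> \<le> L * W" using that by (intro mult_right_mono) auto
        finally show ?thesis
          using p(2)[of "j * W + k"] q[OF that]
            dist_triangle[of "(f ^^ (t + (j * W + k))) p" "(f ^^ k) (x j)" "(f ^^ (j * W + k)) q"]
          by linarith
      qed
      with p(1) show ?thesis by blast
    qed
    then obtain p where p: "\<And>x. (f ^^ M) (p x) = p x"
      "\<And>x j k. j < L \<Longrightarrow> k < n \<Longrightarrow> dist ((f ^^ (t + (j * W + k))) (p x)) ((f ^^ k) (x j)) \<le> e / 4"
      by metis
    have eps: "0 < \<beta> * e / 16" using \<beta> e by simp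
    obtain C where C: "finite C" "C \<subseteq> prob_measures"
      "card C = cover_num f (periodic_measures f) W (\<beta> * e / 16)"
      "\<And>\<mu>. \<mu> \<in> periodic_measures f \<Longrightarrow> \<exists>\<nu>\<in>C. W1n f W \<mu> \<nu> \<le> \<beta> * e / 16"
      using cover_num_attained[OF eps, of W] by metis
    have "M > 0" using G(2) by (simp add: M_def)
    \<comment> \<open>Yields \<open>M \<le> 2 * (L * W)\<close>: closing the orbit at most doubles
      its length.\<close>
    have "G \<le> L * W" using L W by (metis le_trans mult.right_neutral mult_le_mono2 Suc_leI One_nat_def)
    define Y where "Y \<nu> = {x \<in> {..<L} \<rightarrow>\<^sub>E E. W1n f W (pmf_borel (orbit_pmf f (p x) M)) \<nu> \<le> \<beta> * e / 16}" for \<nu>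
    have fin_Y: "finite (Y \<nu>)" for \<nu>
      unfolding Y_def using E(1) by (intro finite_subset[OF _ finite_PiE[of "{..<L}" "\<lambda>_. E"]]) auto
    have "({..<L} \<rightarrow>\<^sub>E E) \<subseteq> (\<Union>\<nu>\<in>C. Y \<nu>)"
      using C(4)[OF orbit_measure_periodic[OF cont \<open>M > 0\<close> p(1)]] unfolding Y_def by blast
    then have "card ({..<L} \<rightarrow>\<^sub>E E) \<le> card (\<Union>\<nu>\<in>C. Y \<nu>)"
      using fin_Y C(1) by (intro card_mono) auto
    also have "\<dots> \<le> (\<Sum>\<nu>\<in>C. card (Y \<nu>))" by (rule card_UN_le[OF C(1)])
    also have "\<dots> \<le> (\<Sum>\<nu>\<in>C. W * (2 ^ L * (Suc M ^ L * card E ^ (2 * nat \<lfloor>\<beta> * real L\<rfloor> + 1))))"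
    proof (rule sum_mono)
      fix \<nu> assume "\<nu> \<in> C"
      then have \<nu>: "\<nu> \<in> prob_measures" using C(2) by blast
      show "card (Y \<nu>) \<le> W * (2 ^ L * (Suc M ^ L * card E ^ (2 * nat \<lfloor>\<beta> * real L\<rfloor> + 1)))"
        unfolding Y_def
        by (rule card_words_near_measure[OF E(1) E(3) E(2) e W(2) W(1) p(2)])
          (use G(1) \<open>G \<le> L * W\<close> \<open>M > 0\<close> \<beta> \<nu> in \<open>auto simp: M_def\<close>)
    qed
    finally show "card E ^ L \<le> cover_num f (periodic_measures f) (n + N) (\<beta> * e / 16) *
        ((n + N) * (2 ^ L * (Suc (L * (n + N) + G) ^ L * card E ^ (2 * nat \<lfloor>\<beta> * real L\<rfloor> + 1))))"
      by (simp add: card_PiE C(3) M_def W_def)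
  qed
qed

text \<open>Take \<open>S\<close> about \<open>exp (c * n)\<close> and \<open>L\<close> about
  \<open>exp (c' * n)\<close> with \<open>c' = (1 - 3 * \<beta>) * c\<close>. Per letter,
  \<open>ln M\<close> costs about \<open>c' * n\<close> and the bad windows
  \<open>2 * \<beta> * c * n\<close>; the remaining \<open>\<beta> * c * n\<close> absorbs all other
  terms and leaves \<open>ln V \<ge> L\<close>.\<close>

lemma measure_entropy_lower_bound:
  assumes e: "e > 0" and \<beta>: "0 < \<beta>" "\<beta> < 1 / 3" and c: "0 < c"
    and less: "ereal c < limsup (\<lambda>n. ereal (ln (real (sep_num f n e)) / real n))"
  shows "ereal ((1 - 3 * \<beta>) * c)
     \<le> limsup (\<lambda>n. ereal (ln (ln (real (cover_num f (periodic_measures f) n (\<beta> * e / 16)))) / real n))"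
    (is "_ \<le> limsup ?g")
proof (rule ccontr)
  obtain N G where G: "G > 0" and words: "\<And>n L E \<beta>. finite E \<Longrightarrow> E \<noteq> {} \<Longrightarrow> separated f n e E \<Longrightarrow> 0 < \<beta> \<Longrightarrow>
      0 < n \<Longrightarrow> G \<le> L \<Longrightarrow>
      card E ^ L \<le> cover_num f (periodic_measures f) (n + N) (\<beta> * e / 16) *
        ((n + N) * (2 ^ L * (Suc (L * (n + N) + G) ^ L * card E ^ (2 * nat \<lfloor>\<beta> * real L\<rfloor> + 1))))"
    using card_words_le_cover_num[OF e] by metis
  define c' where "c' = (1 - 3 * \<beta>) * c"
  have c': "c' > 0" using \<beta> c by (simp add: c'_def)
  assume "\<not> ?thesis"
  then have "limsup ?g < ereal c'" by (simp add: c'_def)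
  then obtain a where a: "limsup ?g < ereal a" "a < c'"
    using ereal_dense2[of "limsup ?g" "ereal c'"] by auto
  have "\<forall>\<^sub>F n in sequentially. ?g n < ereal a" by (rule Limsup_lessD[OF a(1)])
  \<comment> \<open>Windows have length \<open>n + N\<close>; shifting by the fixed gap does not
    change the exponential rate.\<close>
  then have "\<forall>\<^sub>F n in sequentially. ?g (n + N) < ereal a" by (rule sequentially_offset)
  moreover have "\<forall>\<^sub>F n in sequentially. a < (c' * real n - 1) / real (n + N)"
  proof -
    have "(\<lambda>n. (c' * real n - 1) / real (n + N)) \<longlonglongrightarrow> c'" using c' by real_asymp
    then show ?thesis using a(2) by (rule order_tendstoD)
  qed
  moreover have "\<forall>\<^sub>F n in sequentially. 2 \<le> \<beta> * c * real n - ln 2 - ln (real n + real N + real G + 1)"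
    using \<beta> c by real_asymp
  moreover have "\<forall>\<^sub>F n in sequentially. ln (real n + real N) + (c * real n + 1) \<le> exp (c' * real n) - 1"
    using c c' by real_asymp
  moreover have "\<forall>\<^sub>F n in sequentially. real G + 2 \<le> exp (c' * real n)"
    using c' by real_asymp
  ultimately have "\<forall>\<^sub>F n in sequentially. ereal (ln (real (sep_num f n e)) / real n) \<le> ereal c"
    using eventually_gt_at_top[of 0]
  proof eventually_elim
    case (elim n)
    show ?case
    proof (rule ccontr)
      assume "\<not> ?case"
      then have "c * real n \<le> ln (real (sep_num f n e))"
        using elim(6) by (simp add: field_simps)
      then have "exp (c * real n) \<le> real (sep_num f n e)"
        using sep_num_pos[OF e, of n] by (subst (asm) ln_ge_iff) auto
      \<comment> \<open>A maximal separated set may be far larger than \<open>exp (c * n)\<close>;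
        only \<open>S\<close> points are kept, so that \<open>ln S\<close> is bounded above as
        well.\<close>
      define S where "S = nat \<lceil>exp (c * real n)\<rceil>"
      have S_le: "S \<le> sep_num f n e"
        using \<open>exp (c * real n) \<le> _\<close> unfolding S_def by (simp add: ceiling_le_iff nat_le_iff)
      have S_lower: "exp (c * real n) \<le> real S" unfolding S_def by linarith
      have "1 \<le> exp (c * real n)" using c by simp
      then have S_upper: "real S \<le> 2 * exp (c * real n)" unfolding S_def by linarith
      have S1: "1 \<le> real S" using S_lower \<open>1 \<le> exp _\<close> by linarith
      obtain E' where E': "finite E'" "separated f n e E'" "card E' = sep_num f n e"
        using sep_num_attained[OF e] by metis
      obtain E where E: "E \<subseteq> E'" "card E = S" "finite E"
        using obtain_subset_with_card_n[of S E'] S_le E'(3) by metis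
      have sep: "separated f n e E" using E'(2) E(1) by (auto simp: separated_def)
      have "E \<noteq> {}" using E(2) S1 by auto
      define L where "L = nat \<lfloor>exp (c' * real n)\<rfloor>"
      have L: "real L \<le> exp (c' * real n)" "exp (c' * real n) - 1 \<le> real L"
        using exp_ge_zero[of "c' * real n"] unfolding L_def by (simp, linarith)
      have GL: "G \<le> L" using elim(5) L(2) by linarith
      have L1: "1 \<le> real L" using GL G by simp
      define V where "V = cover_num f (periodic_measures f) (n + N) (\<beta> * e / 16)"
      define M where "M = Suc (L * (n + N) + G)"
      have M0: "0 < M" by (simp add: M_def)
      define b where "b = nat \<lfloor>\<beta> * real L\<rfloor>"
      have ineq: "S ^ L \<le> V * ((n + N) * (2 ^ L * (M ^ L * S ^ (2 * b + 1))))"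
        using words[OF E(3) \<open>E \<noteq> {}\<close> sep \<beta>(1) elim(6) GL] unfolding V_def M_def b_def E(2) .
      have "0 < S ^ L" using S1 by simp
      then have V: "0 < V" using ineq by (cases "V = 0") auto
      have "real S ^ L \<le> real V * (real (n + N) * (2 ^ L * (real M ^ L * real S ^ (2 * b + 1))))"
        using of_nat_mono[OF ineq, where 'a = real] by simp
      then have "ln (real S ^ L) \<le> ln (real V * (real (n + N) * (2 ^ L * (real M ^ L * real S ^ (2 * b + 1)))))"
        using S1 by (intro ln_mono) auto
      also have "\<dots> = ln (real V) + (ln (real (n + N)) + (real L * ln 2 + (real L * ln (real M) + real (2 * b + 1) * ln (real S))))"
        using V elim(6) S1 M0 by (simp add: ln_mult ln_realpow) (simp add: algebra_simps)
      finally have main: "real L * ln (real S) \<le> ln (real V) + (ln (real (n + N)) +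
          (real L * ln 2 + (real L * ln (real M) + (2 * real b + 1) * ln (real S))))"
        using S1 by (simp add: ln_realpow algebra_simps)
      define x where "x = ln (real S)"
      have x_lower: "c * real n \<le> x"
        unfolding x_def using S_lower S1 by (subst ln_ge_iff) auto
      have "x \<le> ln (2 * exp (c * real n))"
        unfolding x_def using S_upper S1 by (intro ln_mono) auto
      also have "\<dots> = ln 2 + c * real n" by (simp add: ln_mult)
      finally have x_upper: "x \<le> c * real n + 1" using ln_2_less_1 by linarith
      have "real b \<le> \<beta> * real L" using \<beta>(1) unfolding b_def by simp
      then have bx: "2 * real b * x \<le> 2 * (\<beta> * real L) * x"
        using x_lower c by (intro mult_right_mono mult_left_mono) (auto intro: order_trans[OF _ x_lower])
      have "real M \<le> real L * (real n + real N + real G + 1)"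
      proof -
        have "real G \<le> real L * real G" "1 \<le> real L" using L1 by (simp_all add: mult_le_cancel_right1)
        then show ?thesis by (simp add: M_def algebra_simps)
      qed
      then have "ln (real M) \<le> ln (real L * (real n + real N + real G + 1))"
        using M0 by (intro ln_mono) auto
      also have "\<dots> = ln (real L) + ln (real n + real N + real G + 1)"
        using L1 by (subst ln_mult) auto
      also have "ln (real L) \<le> c' * real n"
        using L(1) L1 by (metis ln_exp ln_mono less_le_trans zero_less_one)
      finally have lnM: "ln (real M) \<le> c' * real n + ln (real n + real N + real G + 1)" by simp
      \<comment> \<open>Since \<open>(1 - 2 * \<beta>) * c - c' = \<beta> * c\<close>, this is the
        reserved slack.\<close>
      have "2 \<le> (1 - 2 * \<beta>) * (c * real n) - ln 2 - (c' * real n + ln (real n + real N + real G + 1))"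
        using elim(3) by (simp add: c'_def algebra_simps)
      also have "\<dots> \<le> (1 - 2 * \<beta>) * x - ln 2 - ln (real M)"
        using mult_left_mono[OF x_lower, of "1 - 2 * \<beta>"] \<beta>(2) lnM by linarith
      finally have "real L * 2 \<le> real L * ((1 - 2 * \<beta>) * x - ln 2 - ln (real M))"
        by (rule mult_left_mono) simp
      \<comment> \<open>The summand 1 in \<open>2 * b + 1\<close> leaves a single \<open>x\<close>,
        which together with \<open>ln (n + N)\<close> is at most \<open>L\<close>; so one of the two
        copies of \<open>L\<close> survives.\<close>
      also have "\<dots> \<le> ln (real V) + ln (real (n + N)) + x"
        using main bx unfolding x_def[symmetric] by (simp add: algebra_simps)
      also have "\<dots> \<le> ln (real V) + real L"
        using elim(4) L(2) x_upper by simp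
      finally have LV: "real L \<le> ln (real V)" by simp
      \<comment> \<open>As \<open>exp (c' * n)\<close> is at least 2, half of it bounds the floor
        from below, at the cost of \<open>ln 2 < 1\<close>.\<close>
      have "exp (c' * real n) / 2 \<le> real L" using L(2) elim(5) by linarith
      then have "ln (exp (c' * real n) / 2) \<le> ln (ln (real V))"
        using LV by (intro ln_mono) auto
      then have "c' * real n - 1 \<le> ln (ln (real V))"
        using ln_2_less_1 by (simp add: ln_div)
      then have "(c' * real n - 1) / real (n + N) \<le> ln (ln (real V)) / real (n + N)"
        by (intro divide_right_mono) auto
      then show False
        using elim(1,2) by (simp add: V_def)
    qed
  qed
  then have "limsup (\<lambda>n. ereal (ln (real (sep_num f n e)) / real n)) \<le> ereal c"
    by (rule Limsup_bounded)
  with less show False by simp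
qed

text \<open>With \<open>ln 0 = 0\<close>, the iterated logarithm of \<open>V\<close> is negative
  only for \<open>V = 2\<close>, and this constant vanishes after division by
  \<open>n\<close>.\<close>

lemma measure_entropy_nonneg:
  "0 \<le> limsup (\<lambda>n. ereal (ln (ln (real (cover_num f Z n e))) / real n))"
proof -
  have "(\<lambda>n. ln (ln 2) / real n) \<longlonglongrightarrow> 0" by real_asymp
  then have "0 = limsup (\<lambda>n. ereal (ln (ln 2) / real n))"
    by (intro lim_imp_Limsup[symmetric]) (auto simp: zero_ereal_def)
  also have "\<dots> \<le> limsup (\<lambda>n. ereal (ln (ln (real (cover_num f Z n e))) / real n))"
  proof (intro Limsup_mono always_eventually allI)
    fix n
    define V where "V = cover_num f Z n e"
    have neg: "ln (ln 2 :: real) \<le> 0" using ln_2_less_1 by simp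
    consider "V = 0" | "V = 1" | "V \<ge> 2" by linarith
    then have "ln (ln 2) \<le> ln (ln (real V))"
      by cases (use neg in auto)
    then show "ereal (ln (ln 2) / real n) \<le> ereal (ln (ln (real (cover_num f Z n e))) / real n)"
      by (simp add: V_def divide_right_mono)
  qed
  finally show ?thesis .
qed

text \<open>Both limits equal the supremum \<open>H\<close> of the separation rates: for
  \<open>s\<close> by monotonicity in \<open>e\<close>, for \<open>g\<close> by the two
  bounds.\<close>

lemma htop_eq_meas_entropy_dim: "htop f = meas_entropy_dim f (periodic_measures f)"
proof -
  define s where "s e = limsup (\<lambda>n. ereal (ln (real (sep_num f n e)) / real n))" for e
  define g where "g e = limsup (\<lambda>n. ereal (ln (ln (real (cover_num f (periodic_measures f) n e))) / real n))" for e
  define H where "H = (SUP e\<in>{0<..}. s e)"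
  have s_le: "s e \<le> H" if "e > 0" for e
    unfolding H_def using that by (intro SUP_upper) auto
  have s_mono: "s e' \<le> s e" if "0 < e" "e \<le> e'" for e e'
    unfolding s_def
  proof (intro Limsup_mono always_eventually allI)
    fix n
    have "ln (real (sep_num f n e')) \<le> ln (real (sep_num f n e))"
      using sep_num_antimono[OF that] sep_num_pos[of e' n] that by (intro ln_mono) auto
    then show "ereal (ln (real (sep_num f n e')) / real n) \<le> ereal (ln (real (sep_num f n e)) / real n)"
      by (simp add: divide_right_mono)
  qed
  have near: "\<forall>\<^sub>F e in at_right 0. 0 < e \<and> e < d" if "d > 0" for d :: real
    using that by (auto simp: eventually_at_right_field intro!: exI[of _ d])
  have "(s \<longlongrightarrow> H) (at_right 0)"
  proof (rule order_tendstoI)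
    fix a assume "a < H"
    then obtain e1 where e1: "e1 > 0" "a < s e1"
      unfolding H_def by (auto simp: less_SUP_iff)
    show "\<forall>\<^sub>F e in at_right 0. a < s e"
      using near[OF e1(1)] by eventually_elim (meson e1(2) s_mono less_imp_le less_le_trans)
  next
    fix a assume "H < a"
    then show "\<forall>\<^sub>F e in at_right 0. s e < a"
      using near[of 1] by (auto elim!: eventually_mono intro: le_less_trans[OF s_le])
  qed
  then have "htop f = H"
    unfolding htop_def s_def by (intro tendsto_Lim) auto
  moreover have "(g \<longlongrightarrow> H) (at_right 0)"
  proof (rule order_tendstoI)
    fix a assume "a < H"
    show "\<forall>\<^sub>F e in at_right 0. a < g e"
    proof (cases "a < 0")
      case True
      then show ?thesis
        unfolding g_def using measure_entropy_nonneg by (intro always_eventually allI) (rule less_le_trans)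
    next
      case False
      then obtain r where r: "a = ereal r" "r \<ge> 0"
        using \<open>a < H\<close> by (cases a) auto
      obtain c where c: "r < c" "ereal c < H"
        using ereal_dense2[OF \<open>a < H\<close>] r(1) by auto
      then obtain e1 where e1: "e1 > 0" "ereal c < s e1"
        unfolding H_def by (auto simp: less_SUP_iff)
      have c0: "c > 0" using c r by simp
      \<comment> \<open>This puts \<open>(1 - 3 * \<beta>) * c\<close> a quarter of the way from
        \<open>r\<close> to \<open>c\<close>.\<close>
      define \<beta> where "\<beta> = (1 - r / c) / 4"
      have "r / c < 1" "0 \<le> r / c" using c r c0 by auto
      then have \<beta>: "0 < \<beta>" "\<beta> < 1 / 3" "r < (1 - 3 * \<beta>) * c"
        using c0 c by (auto simp: \<beta>_def field_simps)
      have "\<beta> * e1 / 16 > 0" using \<beta>(1) e1(1) by simp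
      from near[OF this] show ?thesis
      proof eventually_elim
        case (elim e)
        \<comment> \<open>The scale \<open>e1\<close> stays fixed, and each small \<open>e\<close>
          is written as \<open>\<gamma> * e1 / 16\<close> with \<gamma> below \<beta>; thus the
          lower bound reaches all small \<open>e\<close>.\<close>
        define \<gamma> where "\<gamma> = 16 * e / e1"
        have \<gamma>: "0 < \<gamma>" "\<gamma> < \<beta>" "\<gamma> * e1 / 16 = e"
          using elim e1(1) by (auto simp: \<gamma>_def field_simps)
        have "a < ereal ((1 - 3 * \<beta>) * c)" using r(1) \<beta>(3) by simp
        also have "\<dots> \<le> ereal ((1 - 3 * \<gamma>) * c)"
          using \<gamma>(2) c0 by (simp add: mult_right_mono)
        also have "\<dots> \<le> g e"
          using measure_entropy_lower_bound[OF e1(1) \<gamma>(1) _ c0] \<gamma> \<beta>(2) e1(2)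
          unfolding g_def s_def by simp
        finally show ?case .
      qed
    qed
  next
    fix a assume "H < a"
    have "g e \<le> H" if "e > 0" for e
      using measure_entropy_upper_bound[OF that] s_le[of "e / 2"] that
      unfolding g_def s_def by (meson half_gt_zero order_trans)
    then show "\<forall>\<^sub>F e in at_right 0. g e < a"
      using near[of 1] \<open>H < a\<close> by (auto elim!: eventually_mono intro: le_less_trans)
  qed
  then have "meas_entropy_dim f (periodic_measures f) = H"
    unfolding meas_entropy_dim_def g_def by (intro tendsto_Lim) auto
  ultimately show ?thesis by simp
qed

end

theorem theorem1p4:
  fixes f :: "'a::metric_space \<Rightarrow> 'a"
  assumes "compact (UNIV :: 'a set)"
    and "continuous_on UNIV f"
    and "pos_expansive f"
    and "has_specification f"
  shows "htop f = meas_entropy_dim f (periodic_measures f)"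
proof -
  obtain \<rho> where "\<rho> > 0" "\<And>x y. x \<noteq> y \<Longrightarrow> \<exists>n. dist ((f ^^ n) x) ((f ^^ n) y) > \<rho>"
    using assms(3) unfolding pos_expansive_def by blast
  then interpret specified_system f \<rho>
    using assms(1,2,4) by unfold_locales
  show ?thesis by (rule htop_eq_meas_entropy_dim)
qed

end
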